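(* Let $n,m$ be positive integers with $\gcd(n,m)=1$, $m\neq 1$, and $\frac nm>1$. 1. There is an ascending $1$-stair packing polynomial on $S(n/m)$ if and only if $n\mid (m-1)^2$ and $(m-1)\mid n$. 2. There is an ascending $2$-stair packing polynomial on $S(n/m)$ if and only if $m\equiv 9\pmod{16}$ and $n=\frac1{16}(m-1)^2$. 3. There is an ascending $3$-stair packing polynomial on $S(n/m)$ if and only if either ($m\equiv 10 \pmod{27}$ or $m\equiv 19\pmod{27}$) and $n=\frac1{27}(m-1)^2$, or $\frac nm=\frac{12}{7}$. 4. There are no $4$-stair packing polynomials on $S(n/m)$.
   Context: $\mathbb{N}=\{0,1,2,\dots\}$. For real $\alpha\ge 0$, $S(\alpha)=\{(x,y)\in\mathbb{R}^2 : x,y\ge 0,\ y\le \alpha x\}$ and $I(\alpha)=S(\alpha)\cap\mathbb{Z}^2$. A real polynomial $p(x,y)$ is a packing polynomial on $S(\alpha)$ if $p|_{I(\alpha)}$ is a bijection from $I(\alpha)$ to $\mathbb{N}$. For coprime positive integers $n,m$ and $l=\gcd(n,m-1)$, the $c$-th staircase ($c\in\mathbb{N}$) of $I(n/m)$ is the segment of points $(x,y)\in S(n/m)$ with $nx-(m-1)y=cl$ (for $m\ne 1$: $y=\frac{n}{m-1}x-c\frac{l}{m-1}$). A stair is a point with integer coordinates on a staircase. Two distinct stairs $r,s$ are consecutive if they lie on the same staircase and there is no other stair on the segment from $r$ to $s$. For $k\in\mathbb{N}$, a quadratic polynomial $p$ with homogeneous quadratic part $\frac n2\left(x-\frac{m-1}{n}y\right)^2$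 and $p(\mathbb{Z}^2)\subseteq\mathbb{Z}$ is a $k$-stair polynomial on $S(n/m)$ if $p(r)-p(s)=\pm k$ for any two consecutive stairs $r,s$. It is ascending if $p(s)-p(r)=k$ whenever $r,s$ are consecutive stairs with $|r|<|s|$ (Euclidean norm). A $k$-stair packing polynomial is a $k$-stair polynomial that is also a packing polynomial on $S(n/m)$. *)

theory Defs
  imports "HOL-Analysis.Analysis" "HOL-Computational_Algebra.Polynomial" "HOL-Number_Theory.Cong"
begin

section \<open>Real polynomials in two variables\<close>

text \<open>
  A real polynomial in \<open>x, y\<close> is an element of \<open>\<real>[x][y]\<close>: the inner variable is \<open>x\<close>, the outer
  one is \<open>y\<close>, and the coefficient of \<open>x\<^sup>i y\<^sup>j\<close> in \<open>p\<close> is \<open>coeff (coeff p j) i\<close>.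
\<close>

definition var_x :: "real poly poly"
  where "var_x = [:[:0, 1:]:]"

definition var_y :: "real poly poly"
  where "var_y = [:0, 1:]"

definition const2 :: "real \<Rightarrow> real poly poly"
  where "const2 a = [:[:a:]:]"

definition eval2 :: "real poly poly \<Rightarrow> real \<times> real \<Rightarrow> real"
  where "eval2 p = (\<lambda>(x, y). poly (poly p [:y:]) x)"

definition homogeneous_part :: "nat \<Rightarrow> real poly poly \<Rightarrow> real poly poly"
  where "homogeneous_part d p =
    (\<Sum>j\<le>d. const2 (coeff (coeff p j) (d - j)) * var_x ^ (d - j) * var_y ^ j)"

definition quadratic2 :: "real poly poly \<Rightarrow> bool"
  where "quadratic2 p \<longleftrightarrow>
    homogeneous_part 2 p \<noteq> 0 \<and> (\<forall>d>2. homogeneous_part d p = 0)"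

section \<open>Packing polynomials on sectors\<close>

definition int_lattice :: "(real \<times> real) set"
  where "int_lattice = \<int> \<times> \<int>"

definition sector :: "real \<Rightarrow> (real \<times> real) set"
  where "sector \<alpha> = {(x, y). 0 \<le> x \<and> 0 \<le> y \<and> y \<le> \<alpha> * x}"

definition int_sector :: "real \<Rightarrow> (real \<times> real) set"
  where "int_sector \<alpha> = sector \<alpha> \<inter> int_lattice"

definition packing_polynomial :: "real \<Rightarrow> real poly poly \<Rightarrow> bool"
  where "packing_polynomial \<alpha> p \<longleftrightarrow> bij_betw (eval2 p) (int_sector \<alpha>) \<nat>"

section \<open>Staircases and stair polynomials\<close>

text \<open>
  The definitions below are meant for coprime positive integers \<open>n\<close> and \<open>m\<close>.
\<close>

definition staircase :: "int \<Rightarrow> int \<Rightarrow> nat \<Rightarrow> (real \<times> real) set"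
  where "staircase n m c =
    {(x, y) \<in> sector (real_of_int n / real_of_int m).
       real_of_int n * x - real_of_int (m - 1) * y = real c * real_of_int (gcd n (m - 1))}"

definition stairs :: "int \<Rightarrow> int \<Rightarrow> (real \<times> real) set"
  where "stairs n m = (\<Union>c. staircase n m c) \<inter> int_lattice"

definition consecutive_stairs :: "int \<Rightarrow> int \<Rightarrow> real \<times> real \<Rightarrow> real \<times> real \<Rightarrow> bool"
  where "consecutive_stairs n m r s \<longleftrightarrow>
    r \<in> stairs n m \<and> s \<in> stairs n m \<and> r \<noteq> s \<and>
    (\<exists>c. r \<in> staircase n m c \<and> s \<in> staircase n m c) \<and>
    closed_segment r s \<inter> stairs n m = {r, s}"

definition stair_polynomial :: "nat \<Rightarrow> int \<Rightarrow> int \<Rightarrow> real poly poly \<Rightarrow> bool"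
  where "stair_polynomial k n m p \<longleftrightarrow>
    quadratic2 p \<and>
    homogeneous_part 2 p =
      const2 (real_of_int n / 2) *
      (var_x - const2 (real_of_int (m - 1) / real_of_int n) * var_y) ^ 2 \<and>
    eval2 p ` int_lattice \<subseteq> \<int> \<and>
    (\<forall>r s. consecutive_stairs n m r s \<longrightarrow>
       eval2 p r - eval2 p s = real k \<or> eval2 p r - eval2 p s = - real k)"

definition ascending_stair_polynomial :: "nat \<Rightarrow> int \<Rightarrow> int \<Rightarrow> real poly poly \<Rightarrow> bool"
  where "ascending_stair_polynomial k n m p \<longleftrightarrow>
    stair_polynomial k n m p \<and>
    (\<forall>r s. consecutive_stairs n m r s \<and> norm r < norm s \<longrightarrow> eval2 p s - eval2 p r = real k)"

definition stair_packing_polynomial :: "nat \<Rightarrow> int \<Rightarrow> int \<Rightarrow> real poly poly \<Rightarrow> bool"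
  where "stair_packing_polynomial k n m p \<longleftrightarrow>
    stair_polynomial k n m p \<and> packing_polynomial (real_of_int n / real_of_int m) p"

definition ascending_stair_packing_polynomial :: "nat \<Rightarrow> int \<Rightarrow> int \<Rightarrow> real poly poly \<Rightarrow> bool"
  where "ascending_stair_packing_polynomial k n m p \<longleftrightarrow>
    ascending_stair_polynomial k n m p \<and> stair_packing_polynomial k n m p"

end

theory Submission
  imports Defs
begin

text \<open>
  Integrality of \<open>p\<close> forces \<open>n\<close> to divide \<open>(m - 1)\<^sup>2\<close>, hence \<open>n = a\<^sup>2 t\<close> and \<open>m - 1 = a b t\<close> with
  \<open>a\<close>, \<open>b\<close> coprime and \<open>b < a\<close>. Let \<open>h\<close> be the inverse of \<open>b\<close> modulo \<open>a\<close>. In lattice coordinates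
  \<open>(u, v)\<close> with \<open>u = a x - b y\<close>, the \<open>u\<close>-th staircase is a run of \<open>t u + [a dvd u]\<close> consecutive
  values of \<open>v\<close> starting at the ceiling of \<open>u h / a\<close>, and \<open>p = t u (u - 1) / 2 + L u \<plusminus> k v + D\<close> with
  integers \<open>L\<close>, \<open>D\<close>. So \<open>p\<close> maps each staircase to an arithmetic progression of difference \<open>k\<close>, and
  these must tile the residue classes modulo \<open>k\<close>. By growth, the progression following that of
  staircase \<open>u\<close> is that of staircase \<open>u + k\<close>; this gives \<open>k h = 1\<close> modulo \<open>a\<close> (so \<open>b = k\<close> modulo \<open>a\<close>) and
  determines \<open>L\<close>. The tiling then exists iff the first \<open>k\<close> progressions start at \<open>0, \<dots>, k - 1\<close> in
  some order, a finite condition on \<open>t\<close> for each \<open>k\<close>.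
\<close>

section \<open>Tilings by arithmetic progressions\<close>

text \<open>
  The point \<open>(u, v)\<close> stands for the \<open>v\<close>-th stair of the \<open>u\<close>-th staircase, with
  \<open>u h / a \<le> v \<le> t u + u h / a\<close>.
\<close>

definition stair_region :: "int \<Rightarrow> int \<Rightarrow> int \<Rightarrow> (int \<times> int) set"
  where "stair_region a h t = {(u, v). 0 \<le> u \<and> u * h \<le> a * v \<and> a * v \<le> a * t * u + u * h}"

text \<open>The triangular number in place of \<open>u^2 / 2\<close> keeps every value an integer
  even for odd \<open>t\<close>, so that \<open>L\<close> and \<open>D\<close> may range over all
  integers.\<close>

definition stair_value :: "int \<Rightarrow> int \<Rightarrow> int \<Rightarrow> int \<Rightarrow> int \<times> int \<Rightarrow> int"
  where "stair_value t K L D = (\<lambda>(u, v). t * (u * (u - 1) div 2) + L * u + K * v + D)"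

lemma two_triangle: "2 * (u * (u - 1) div 2) = u * (u - 1)" for u :: int
  by simp

lemma triangle_add:
  "(u + w) * (u + w - 1) div 2 = u * (u - 1) div 2 + w * (w - 1) div 2 + u * w" for u w :: int
proof -
  have "2 * ((u + w) * (u + w - 1) div 2) = 2 * (u * (u - 1) div 2 + w * (w - 1) div 2 + u * w)"
    unfolding distrib_left two_triangle by algebra
  then show ?thesis unfolding mult_cancel_left by simp
qed

section \<open>First stairs and lengths of the staircases\<close>

locale stair_tiling =
  fixes a h t k L D :: int
  assumes h_pos: "0 < h" and h_less: "h < a" and coprime_h: "coprime h a"
    and t_pos: "0 < t" and k_pos: "0 < k"
begin

text \<open>The ceiling of \<open>u * h / a\<close>, as the negated floor of the negated
  quotient.\<close>

definition low :: "int \<Rightarrow> int" where "low u = - ((- (u * h)) div a)"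
text \<open>The admissible \<open>v\<close> fill a closed interval of length \<open>t * u\<close>;
  it holds one more integer when its end points are integers, that is, when
  \<open>a dvd u\<close>.\<close>

definition len :: "int \<Rightarrow> int" where "len u = t * u + (if a dvd u then 1 else 0)"
definition start :: "int \<Rightarrow> int" where "start u = stair_value t k L D (u, low u)"

lemma a_gt: "1 < a" using h_pos h_less by linarith

lemma low_bounds: "u * h \<le> a * low u" "a * low u < u * h + a"
proof -
  have "- (u * h) = a * ((- (u * h)) div a) + (- (u * h)) mod a" by simp
  moreover have "0 \<le> (- (u * h)) mod a" "(- (u * h)) mod a < a" using a_gt by auto
  ultimately show "u * h \<le> a * low u" "a * low u < u * h + a"
    unfolding low_def mult_minus_right by linarith+
qed

lemma le_low_iff: "low u \<le> v \<longleftrightarrow> u * h \<le> a * v"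
proof
  assume "low u \<le> v"
  then have "a * low u \<le> a * v" using a_gt by simp
  then show "u * h \<le> a * v" using low_bounds(1)[of u] by simp
next
  assume "u * h \<le> a * v"
  then have "a * low u < a * (v + 1)" using low_bounds(2)[of u] by (simp add: distrib_left)
  then show "low u \<le> v" using a_gt by simp
qed

lemma low_eqI: "u * h \<le> a * v \<Longrightarrow> a * v < u * h + a \<Longrightarrow> low u = v"
  using le_low_iff[of u v] le_low_iff[of u "v - 1"] by (auto simp: algebra_simps)

lemma len_pos: "0 \<le> u \<Longrightarrow> 0 < len u"
  using t_pos by (cases "u = 0") (auto simp: len_def intro: add_pos_nonneg)

lemma dvd_iff_low: "a dvd u \<longleftrightarrow> a * low u = u * h"
proof
  assume "a dvd u"
  then obtain w where "u = a * w" ..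
  then have "low u = w * h" using a_gt by (intro low_eqI) (auto simp: algebra_simps)
  then show "a * low u = u * h" using \<open>u = a * w\<close> by simp
next
  assume "a * low u = u * h"
  then have "a dvd u * h" by (metis dvd_triv_left)
  then show "a dvd u" using coprime_h by (simp add: coprime_commute coprime_dvd_mult_left_iff)
qed

lemma region_iff: "(u, v) \<in> stair_region a h t \<longleftrightarrow> 0 \<le> u \<and> low u \<le> v \<and> v < low u + len u"
proof -
  have "a * v \<le> a * t * u + u * h \<longleftrightarrow> v < low u + len u"
  proof -
    have "a * v \<le> a * t * u + u * h \<longleftrightarrow> a * (v - t * u) \<le> u * h"
      by (simp add: algebra_simps)
    also have "\<dots> \<longleftrightarrow> v - t * u < low u + (if a dvd u then 1 else 0)"
    proof (cases "a dvd u")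
      case True
      then have "u * h = a * low u" using dvd_iff_low by simp
      then show ?thesis using True a_gt by (simp)
    next
      case False
      then have "u * h < a * low u" using dvd_iff_low low_bounds(1)[of u] by fastforce
      then have "v - t * u < low u \<or> \<not> a * (v - t * u) \<le> u * h"
        by (smt (verit) a_gt mult_left_mono)
      moreover have "a * (v - t * u) \<le> u * h" if "v - t * u < low u"
      proof -
        have "a * (v - t * u) \<le> a * (low u - 1)" using that a_gt by (intro mult_left_mono) auto
        also have "\<dots> \<le> u * h" using low_bounds(2)[of u] by (simp add: algebra_simps)
        finally show ?thesis .
      qed
      ultimately show ?thesis using False by auto
    qed
    finally show ?thesis by (auto simp: len_def)
  qed
  then show ?thesis by (auto simp: stair_region_def le_low_iff)
qed

lemma value_eq_start: "stair_value t k L D (u, low u + j) = start u + k * j"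
  by (simp add: stair_value_def start_def algebra_simps)

lemma start_add:
  "start (u + w) = start u + t * (u * w) + t * (w * (w - 1) div 2) + L * w + k * (low (u + w) - low u)"
  unfolding start_def stair_value_def prod.case triangle_add by algebra

text \<open>The slope \<open>h / a\<close> lies strictly between 0 and 1.\<close>

lemma low_Suc: "low u \<le> low (u + 1)" "low (u + 1) \<le> low u + 1"
proof -
  have "u * h \<le> a * low (u + 1)" using low_bounds(1)[of "u + 1"] h_pos by (simp add: algebra_simps)
  then show "low u \<le> low (u + 1)" by (simp add: le_low_iff)
  show "low (u + 1) \<le> low u + 1"
    using low_bounds(1)[of u] h_less by (simp add: le_low_iff algebra_simps)
qed

lemma low_mono: "u \<le> w \<Longrightarrow> low u \<le> low w"
  using h_pos low_bounds(1)[of w] by (simp add: le_low_iff) (smt (verit) mult_right_mono)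

lemma start_Suc_ge: "start (u + 1) \<ge> start u + t * u + L"
  using start_add[of u 1] low_Suc[of u] k_pos by simp

lemma low_add_le: "low (u + w) \<le> low u + low w"
proof -
  have "(u + w) * h \<le> a * (low u + low w)"
    using low_bounds(1)[of u] low_bounds(1)[of w] by (simp add: algebra_simps)
  then show ?thesis by (simp add: le_low_iff)
qed

text \<open>The increments are at least \<open>t * u + L\<close>, hence eventually positive, and the
  finitely many earlier starts are overtaken. This lets starts be compared by their indices
  alone.\<close>

lemma eventually_start_max: "\<exists>U\<ge>B. \<forall>u\<ge>U. \<forall>w. 0 \<le> w \<and> w \<le> u \<longrightarrow> start w \<le> start u"
proof -
  define V where "V = max B (\<bar>L\<bar> + 1)"
  have step: "start u + 1 \<le> start (u + 1)" if "V \<le> u" for u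
  proof -
    have "0 \<le> u" using that V_def by linarith
    then have "u \<le> t * u" using t_pos mult_right_mono[of 1 t u] by simp
    then show ?thesis using start_Suc_ge[of u] that V_def by linarith
  qed
  have lin: "start u + int i \<le> start (u + int i)" if "V \<le> u" for u i
  proof (induction i)
    case (Suc i)
    then show ?case using step[of "u + int i"] that by (simp add: algebra_simps)
  qed simp
  have mono: "start u \<le> start w" if "V \<le> u" "u \<le> w" for u w
    using lin[OF that(1), of "nat (w - u)"] that(2) by simp
  define C where "C = Max (start ` {0..V})"
  have C: "start w \<le> C" if "0 \<le> w" "w \<le> V" for w
    unfolding C_def using that by (intro Max_ge) auto
  \<comment> \<open>Beyond \<open>V\<close> every step gains at least 1, so this many steps suffice
    to reach the maximum \<open>C\<close> over the initial segment.\<close>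
  define U where "U = V + \<bar>C - start V\<bar>"
  have U: "C \<le> start U" using lin[of V "nat \<bar>C - start V\<bar>"] by (simp add: U_def)
  have "start w \<le> start u" if "U \<le> u" "0 \<le> w" "w \<le> u" for u w
  proof (cases "w \<le> V")
    case True
    have "start w \<le> start U" using C[OF that(2) True] U by simp
    also have "\<dots> \<le> start u" using that by (intro mono) (auto simp: U_def)
    finally show ?thesis .
  next
    case False
    then show ?thesis using mono that by simp
  qed
  moreover have "U \<ge> B" by (simp add: U_def V_def)
  ultimately show ?thesis by blast
qed

section \<open>Consequences of bijectivity\<close>

context
  assumes bij: "bij_betw (stair_value t k L D) (stair_region a h t) {0..}"
begin

lemma value_nonneg: "0 \<le> u \<Longrightarrow> 0 \<le> j \<Longrightarrow> j < len u \<Longrightarrow> 0 \<le> start u + k * j"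
  using bij_betwE[OF bij] region_iff[of u "low u + j"] value_eq_start[of u j]
  by fastforce

lemma value_surj:
  assumes "0 \<le> x"
  obtains u j where "0 \<le> u" "0 \<le> j" "j < len u" "x = start u + k * j"
proof -
  have "x \<in> stair_value t k L D ` stair_region a h t"
    using assms bij by (simp add: bij_betw_def)
  then obtain u v where uv: "(u, v) \<in> stair_region a h t" "x = stair_value t k L D (u, v)" by auto
  show thesis
    using that[of u "v - low u"] uv region_iff[of u v] value_eq_start[of u "v - low u"] by auto
qed

lemma value_inj:
  assumes "0 \<le> u" "0 \<le> j" "j < len u" "0 \<le> w" "0 \<le> i" "i < len w" "start u + k * j = start w + k * i"
  shows "u = w \<and> j = i"
proof -
  have "(u, low u + j) = (w, low w + i)"
    using bij assms by (intro inj_onD[of "stair_value t k L D" "stair_region a h t"])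
      (auto simp: bij_betw_def value_eq_start region_iff)
  then show ?thesis by auto
qed

text \<open>
  The value \<open>k\<close> above the last one of a staircase can only be attained at a first stair, as
  otherwise its predecessor there would have the same value as that last stair.
\<close>

lemma start_after_end:
  assumes "0 \<le> u"
  shows "\<exists>w\<ge>0. start w = start u + k * len u"
proof -
  have "0 \<le> start u + k * len u"
    using value_nonneg[OF assms, of 0] len_pos[OF assms] k_pos by simp
  then obtain w j where w: "0 \<le> w" "0 \<le> j" "j < len w" "start u + k * len u = start w + k * j"
    using value_surj by blast
  have "j = 0"
  proof (rule ccontr)
    assume "j \<noteq> 0"
    with w have j: "0 \<le> j - 1" by simp
    have "u = w \<and> len u - 1 = j - 1"
      using j w assms len_pos[OF assms] by (intro value_inj) (auto simp: right_diff_distrib)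
    then show False using w by auto
  qed
  then show ?thesis using w by auto
qed

text \<open>
  Both \<open>start (u + k) - start u\<close> and \<open>k * len u\<close> equal \<open>k * t * u\<close> up to a bounded error, whereas
  consecutive values of \<open>start\<close> differ by about \<open>t * u\<close>.
\<close>

lemma eventually_start_shift: "\<exists>U\<ge>0. \<forall>u\<ge>U. start (u + k) = start u + k * len u"
proof -
  define S where "S = t * (k * (k - 1) div 2)"
  \<comment> \<open>This collects the bounded errors of the estimates below; from \<open>U\<close>
    on, \<open>t * u\<close> is at least \<open>B\<close> and dominates them.\<close>
  define B where "B = 2 * \<bar>L\<bar> + \<bar>L * k\<bar> + \<bar>S\<bar> + k * low k + k + k * t + 1"
  have low_k: "0 \<le> low k" using low_mono[of 0 k] low_eqI[of 0 0] a_gt k_pos by simp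
  have "B \<ge> 1" using low_k k_pos t_pos by (simp add: B_def)
  obtain U where U: "U \<ge> B" "\<And>u w. U \<le> u \<Longrightarrow> 0 \<le> w \<Longrightarrow> w \<le> u \<Longrightarrow> start w \<le> start u"
    using eventually_start_max by meson
  have "start (u + k) = start u + k * len u" if u: "U \<le> u" for u
  proof -
    have tu: "B \<le> t * u"
      using u U(1) \<open>B \<ge> 1\<close> t_pos by (smt (verit) mult_le_cancel_right1)
    have up: "k * (low (u + k) - low u) \<le> k * low k"
      using low_add_le[of u k] k_pos by (intro mult_left_mono) auto
    have dn: "0 \<le> k * (low (u + k) - low u)"
      using low_mono[of u "u + k"] k_pos by simp
    have sk: "start (u + k) = start u + k * (t * u) + S + L * k + k * (low (u + k) - low u)"
      using start_add[of u k] by (simp add: S_def algebra_simps)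
    have len: "k * (t * u) \<le> k * len u" "k * len u \<le> k * (t * u) + k"
      using k_pos by (auto simp: len_def algebra_simps)
    have kt: "0 \<le> k * low k" "0 < k * t" using k_pos t_pos low_k by auto
    obtain w where w: "0 \<le> w" "start w = start u + k * len u"
      using start_after_end[of u] u U(1) \<open>B \<ge> 1\<close> by force
    \<comment> \<open>Indices other than \<open>u + k\<close> have starts at distance about
      \<open>t * u\<close> or more from \<open>start (u + k)\<close>, while \<open>start w\<close>
      stays within a bounded distance of it. Both directions are excluded in this way.\<close>
    have "\<not> w \<le> u + k - 1"
    proof
      assume "w \<le> u + k - 1"
      then have "start w \<le> start (u + k - 1)"
        using U(2)[of "u + k - 1" w] w u k_pos by simp
      moreover have "start (u + k) \<ge> start (u + k - 1) + t * (u + k - 1) + L"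
        using start_Suc_ge[of "u + k - 1"] by simp
      moreover have "t * (u + k - 1) \<ge> t * u" using t_pos k_pos by simp
      ultimately show False
        using w(2) sk up len tu kt B_def k_pos by linarith
    qed
    moreover have "\<not> w \<ge> u + k + 1"
    proof
      assume "w \<ge> u + k + 1"
      then have "start w \<ge> start (u + k + 1)"
        using U(2)[of w "u + k + 1"] u k_pos U(1) \<open>B \<ge> 1\<close> by simp
      moreover have "start (u + k + 1) \<ge> start (u + k) + t * (u + k) + L"
        using start_Suc_ge[of "u + k"] by simp
      moreover have "t * (u + k) \<ge> t * u" using t_pos k_pos by simp
      ultimately show False
        using w(2) sk dn len tu kt B_def k_pos by linarith
    qed
    ultimately have "w = u + k" by simp
    then show ?thesis using w by simp
  qed
  then show ?thesis using U(1) \<open>B \<ge> 1\<close> by (intro exI[of _ U]) auto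
qed

text \<open>The eventual shift law is evaluated at two large indices. A multiple of \<open>a\<close>
  gives the second equation with \<open>M = 1 - low k\<close>; an index with \<open>u * h\<close>
  congruent to -1 modulo \<open>a\<close> shows that lowering \<open>k * h / a\<close> by
  \<open>1 / a\<close> lowers its ceiling, so \<open>k * h\<close> is 1 modulo
  \<open>a\<close>.\<close>

lemma period_equations:
  "\<exists>M. a * M = 1 - k * h \<and> 2 * M = t * (k - 1) + 2 * L"
proof -
  define S where "S = t * (k * (k - 1) div 2)"
  obtain U where U: "U \<ge> 0" "\<And>u. u \<ge> U \<Longrightarrow> start (u + k) = start u + k * len u"
    using eventually_start_shift by blast
  have diff: "k * (low (u + k) - low u) + S + L * k = k * (if a dvd u then 1 else 0)" if "U \<le> u" for u
    using U(2)[OF that] start_add[of u k] by (simp add: S_def len_def algebra_simps)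
  have aU: "U \<le> a * U" using U(1) a_gt mult_right_mono[of 1 a U] by simp
  have "low (a * U) = U * h" by (rule low_eqI) (use a_gt in auto)
  moreover have "low (a * U + k) = U * h + low k"
    by (rule low_eqI) (use low_bounds[of k] in \<open>auto simp: algebra_simps\<close>)
  ultimately have k: "k * low k + S + L * k = k" using diff[OF aU] by simp
  have "2 * S = t * (k * (k - 1))" using two_triangle[of k] by (simp add: S_def algebra_simps)
  then have "k * (2 * (1 - low k)) = k * (t * (k - 1) + 2 * L)" using k by algebra
  then have M: "2 * (1 - low k) = t * (k - 1) + 2 * L" using k_pos by simp
  obtain x where x: "[h * x = 1] (mod a)" using coprime_h cong_solve_coprime_int by blast
  \<comment> \<open>Since \<open>x\<close> inverts \<open>h\<close> modulo \<open>a\<close>, this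
    index has \<open>u * h\<close> congruent to -1; the summand \<open>a * U\<close> only makes it
    large.\<close>
  define u where "u = (- x) mod a + a * U"
  have "U \<le> u" using aU a_gt by (simp add: u_def add_increasing)
  have "[u = - x] (mod a)" by (simp add: u_def cong_def)
  then have "[u * h + 1 = - x * h + h * x] (mod a)"
    using x by (meson cong_add cong_mult cong_refl cong_sym)
  then have "a dvd u * h + 1" by (simp add: cong_0_iff mult.commute)
  then obtain q where q: "u * h + 1 = a * q" ..
  have "low u = q" using q a_gt by (intro low_eqI) auto
  moreover have "\<not> a dvd u" using dvd_iff_low[of u] q \<open>low u = q\<close> by simp
  ultimately have "k * (low (u + k) - q) + S + L * k = 0" using diff[OF \<open>U \<le> u\<close>] by simp
  then have "k * (low (u + k) - q) = k * (low k - 1)" using k by (simp add: algebra_simps)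
  then have "low (u + k) = q + low k - 1" using k_pos by simp
  then have "(u + k) * h \<le> a * (q + low k - 1)" using low_bounds(1)[of "u + k"] by simp
  then have "k * h \<le> 1 + a * low k - a" using q by (simp add: algebra_simps)
  moreover have "a * low k < k * h + a" using low_bounds(2)[of k] .
  ultimately have "a * (1 - low k) = 1 - k * h" by (simp add: algebra_simps)
  then show ?thesis using M by blast
qed

end

text \<open>Conversely, the two equations give the shift law for every \<open>u\<close>: as
  \<open>k * h = 1 - a * M\<close>, passing to \<open>u + k\<close> adds \<open>1 / a - M\<close> to
  \<open>u * h / a\<close>, and the \<open>1 / a\<close> raises the ceiling exactly when
  \<open>a dvd u\<close>. This matches the extra stair counted by \<open>len\<close>.\<close>

lemma start_shift:
  assumes "a * M = 1 - k * h" "2 * M = t * (k - 1) + 2 * L"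
  shows "start (u + k) = start u + k * len u"
proof -
  define e :: int where "e = (if a dvd u then 1 else 0)"
  have "low (u + k) = low u + e - M"
    by (rule low_eqI)
      (use low_bounds[of u] dvd_iff_low[of u] assms(1) a_gt in \<open>auto simp: e_def algebra_simps\<close>)
  then have "k * (low (u + k) - low u) = k * e - k * M" by algebra
  moreover have "2 * (t * (k * (k - 1) div 2) + L * k) = 2 * (k * M)"
    using two_triangle[of k] assms(2) by algebra
  then have "t * (k * (k - 1) div 2) + L * k = k * M" by simp
  ultimately show ?thesis
    using start_add[of u k] unfolding len_def e_def[symmetric]
    by (simp add: algebra_simps)
qed

text \<open>With the shift law, staircases \<open>u\<close>, \<open>u + k\<close>,
  \<open>u + 2 * k\<close>, ... join into one progression of difference \<open>k\<close>. These
  \<open>k\<close> progressions tile the naturals iff their first terms are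
  \<open>0, ..., k - 1\<close> in some order.\<close>

lemma bij_iff_starts:
  "bij_betw (stair_value t k L D) (stair_region a h t) {0..} \<longleftrightarrow>
    (\<exists>M. a * M = 1 - k * h \<and> 2 * M = t * (k - 1) + 2 * L) \<and> start ` {0..<k} = {0..<k}"
  (is "?bij \<longleftrightarrow> ?eqs \<and> ?starts")
proof (intro iffI conjI)
  assume bij: ?bij
  show ?eqs using period_equations[OF bij] .
  then obtain M where M: "a * M = 1 - k * h" "2 * M = t * (k - 1) + 2 * L" by blast
  have "x \<in> start ` {0..<k}" if x: "x \<in> {0..<k}" for x
  proof -
    obtain u j where u: "0 \<le> u" "0 \<le> j" "j < len u" "x = start u + k * j"
      using value_surj[OF bij, of x] x by auto
    \<comment> \<open>A value below \<open>k\<close> has no predecessor in its progression: the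
      value \<open>k\<close> less would be negative. So it is a first stair, and its index is below
      \<open>k\<close>.\<close>
    have "j = 0"
    proof (rule ccontr)
      assume "j \<noteq> 0"
      then have "0 \<le> start u + k * (j - 1)" using u by (intro value_nonneg[OF bij]) auto
      then show False using u x by (simp add: right_diff_distrib)
    qed
    moreover have "u < k"
    proof (rule ccontr)
      assume "\<not> u < k"
      then have "0 \<le> start (u - k) + k * (len (u - k) - 1)"
        using len_pos[of "u - k"] by (intro value_nonneg[OF bij]) auto
      then show False using start_shift[OF M, of "u - k"] u x \<open>j = 0\<close> by (simp add: right_diff_distrib)
    qed
    ultimately show ?thesis using u by auto
  qed
  then have "{0..<k} \<subseteq> start ` {0..<k}" by blast
  then show ?starts
    using card_image_le[of "{0..<k}" start] by (intro card_seteq[symmetric]) auto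
next
  assume R: "?eqs \<and> ?starts"
  then obtain M where M: "a * M = 1 - k * h" "2 * M = t * (k - 1) + 2 * L" by blast
  note shift = start_shift[OF M]
  have inj: "inj_on start {0..<k}" using R by (intro eq_card_imp_inj_on) auto
  \<comment> \<open>Strong induction along the shift law: a start of index at least \<open>k\<close>
    is an earlier nonnegative start plus a positive multiple of \<open>k\<close>.\<close>
  have bound: "if u < k then 0 \<le> start u \<and> start u < k else k \<le> start u" if "0 \<le> u" for u
    using that
  proof (induction "nat u" arbitrary: u rule: less_induct)
    case less
    show ?case
    proof (cases "u < k")
      case True
      then have "start u \<in> {0..<k}" using R less.prems by (metis atLeastLessThan_iff image_eqI)
      then show ?thesis using True by simp
    next
      case False
      then have "0 \<le> start (u - k)" using less.hyps[of "u - k"] k_pos by (auto split: if_splits)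
      moreover have "k * 1 \<le> k * len (u - k)"
        using len_pos[of "u - k"] False k_pos by (intro mult_left_mono) auto
      ultimately show ?thesis using shift[of "u - k"] False by simp
    qed
  qed
  \<comment> \<open>The stair whose value is smaller by \<open>k\<close>: the previous one on the
    same staircase or, for a first stair, the last one of staircase \<open>u - k\<close>.\<close>
  define pred where "pred u j = (if j > 0 then (u, j - 1) else (u - k, len (u - k) - 1))" for u j
  have pred: "0 \<le> fst (pred u j) \<and> 0 \<le> snd (pred u j) \<and> snd (pred u j) < len (fst (pred u j)) \<and>
      start (fst (pred u j)) + k * snd (pred u j) = start u + k * j - k"
    if "0 \<le> u" "0 \<le> j" "j < len u" "k \<le> start u + k * j" for u j
  proof (cases "j > 0")
    case False
    then have "k \<le> u" using that bound[of u] by (auto split: if_splits)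
    then show ?thesis using False that shift[of "u - k"] len_pos[of "u - k"]
      by (auto simp: pred_def right_diff_distrib)
  qed (use that in \<open>auto simp: pred_def right_diff_distrib\<close>)
  have zero: "j = 0" if "0 \<le> u" "0 \<le> j" "start u + k * j < k" for u j
  proof (rule ccontr)
    assume "j \<noteq> 0"
    then have "k * 1 \<le> k * j" using that k_pos by (intro mult_left_mono) auto
    moreover have "0 \<le> start u" using bound[OF that(1)] k_pos by (auto split: if_splits)
    ultimately show False using that by simp
  qed
  have uniq: "u = w \<and> j = i"
    if "start u + k * j = x" "start w + k * i = x"
      "0 \<le> u" "0 \<le> j" "j < len u" "0 \<le> w" "0 \<le> i" "i < len w" for x u j w i
    using that
  proof (induction "nat x" arbitrary: x u j w i rule: less_induct)
    case less
    show ?case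
    proof (cases "x < k")
      case True
      then have small: "start u + k * j < k" "start w + k * i < k" using less.prems(1,2) by linarith+
      have ji: "j = 0" "i = 0" by (rule zero; use less.prems small in blast)+
      have "u < k" "w < k"
        using bound[OF less.prems(3)] bound[OF less.prems(6)] small unfolding ji
        by (auto split: if_splits)
      moreover have "start u = start w" using less.prems(1,2) unfolding ji by linarith
      ultimately show ?thesis using inj_onD[OF inj, of u w] less.prems(3,6) ji by simp
    next
      case False
      then have "k \<le> start u + k * j" "k \<le> start w + k * i" using less.prems(1,2) by linarith+
      note pu = pred[OF less.prems(3-5) this(1), unfolded less.prems(1)]
        and pw = pred[OF less.prems(6-8) this(2), unfolded less.prems(2)]
      have "nat (x - k) < nat x" using False k_pos by simp
      then have "fst (pred u j) = fst (pred w i) \<and> snd (pred u j) = snd (pred w i)"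
        using pu pw by (intro less.hyps[of "x - k"]) blast+
      \<comment> \<open>\<open>pred\<close> is injective on stairs: if only one of \<open>j\<close>,
        \<open>i\<close> were zero, the other would equal the length of its staircase.\<close>
      then show ?thesis using less.prems(3-8) by (auto simp: pred_def split: if_splits)
    qed
  qed
  have ex: "\<exists>u j. 0 \<le> u \<and> 0 \<le> j \<and> j < len u \<and> start u + k * j = x" if "0 \<le> x" for x
    using that
  proof (induction "nat x" arbitrary: x rule: less_induct)
    case less
    show ?case
    proof (cases "x < k")
      case True
      then have "x \<in> start ` {0..<k}" using R less.prems by simp
      then obtain u where "0 \<le> u" "start u = x" by auto
      then show ?thesis using len_pos[of u] by (intro exI[of _ u] exI[of _ 0]) auto
    next
      case False
      then obtain u j where u: "0 \<le> u" "0 \<le> j" "j < len u" "start u + k * j = x - k"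
        using less.hyps[of "x - k"] k_pos by auto
      show ?thesis
      proof (cases "j + 1 < len u")
        case True
        then show ?thesis using u by (intro exI[of _ u] exI[of _ "j + 1"]) (auto simp: algebra_simps)
      next
        case False
        then have "len u = j + 1" using u by simp
        then show ?thesis using u shift[of u] len_pos[of "u + k"] k_pos
          by (intro exI[of _ "u + k"] exI[of _ 0]) (auto simp: algebra_simps)
      qed
    qed
  qed
  have val: "stair_value t k L D (u, v) = start u + k * (v - low u)" for u v
    using value_eq_start[of u "v - low u"] by simp
  show ?bij
  proof (rule bij_betwI')
    fix p q assume "p \<in> stair_region a h t" "q \<in> stair_region a h t"
    then show "(stair_value t k L D p = stair_value t k L D q) = (p = q)"
      using uniq[OF _ refl, of "fst p" "snd p - low (fst p)" "fst q" "snd q - low (fst q)"]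
      by (cases p; cases q) (fastforce simp: val region_iff)
  next
    fix p assume "p \<in> stair_region a h t"
    then show "stair_value t k L D p \<in> {0..}"
      using bound[of "fst p"] k_pos by (cases p) (auto simp: val region_iff split: if_splits)
  next
    fix x :: int assume "x \<in> {0..}"
    then obtain u j where "0 \<le> u" "0 \<le> j" "j < len u" "start u + k * j = x" using ex[of x] by auto
    then show "\<exists>p\<in>stair_region a h t. x = stair_value t k L D p"
      by (intro bexI[of _ "(u, low u + j)"]) (auto simp: val region_iff)
  qed
qed

end

section \<open>The criterion for differences 1, 2, 3 and 4\<close>

lemma bij_stair_value_1_iff:
  assumes "0 < h" "h < a" "coprime h a" "0 < t"
  shows "(\<exists>L D. bij_betw (stair_value t 1 L D) (stair_region a h t) {0..}) \<longleftrightarrow> h = 1"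
proof -
  \<comment> \<open>\<open>L\<close> and \<open>D\<close> are quantified in the claim, so they stay
    free and become arguments of \<open>start\<close>.\<close>
  interpret stair_tiling a h t 1 L D for L D using assms by unfold_locales auto
  have range: "{0..<1::int} = {0}" by auto
  have start: "start L D 0 = D" for L D
    using low_eqI[of 0 0] a_gt by (simp add: start_def stair_value_def)
  show ?thesis
  proof
    assume "\<exists>L D. bij_betw (stair_value t 1 L D) (stair_region a h t) {0..}"
    then obtain M where M: "a * M = 1 - h" using bij_iff_starts by auto
    \<comment> \<open>For difference \<open>k\<close>, the bounds \<open>0 < h < a\<close> and
      \<open>a * M = 1 - k * h\<close> give \<open>- k < M\<close> and \<open>M \<le> 0\<close>. The
      lemmas for 2, 3 and 4 confine \<open>M\<close> in the same way.\<close>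
    have "- 1 < M"
    proof (rule ccontr)
      assume "\<not> - 1 < M"
      then have "a * M \<le> a * (- 1)" using a_gt by (intro mult_left_mono) auto
      then show False using M h_less by simp
    qed
    then have "0 \<le> a * M" using a_gt by simp
    then show "h = 1" using M assms by simp
  next
    assume "h = 1"
    then have "bij_betw (stair_value t 1 0 0) (stair_region a h t) {0..}"
      unfolding bij_iff_starts range using start by auto
    then show "\<exists>L D. bij_betw (stair_value t 1 L D) (stair_region a h t) {0..}" by blast
  qed
qed

text \<open>Only \<open>M = - 1\<close> remains, so \<open>t\<close> is even and the starts are
  \<open>D\<close> and \<open>D + 1 - t / 2\<close>. They are 0 and 1 in some order only for
  \<open>t = 4\<close> and \<open>D = 1\<close>, which gives \<open>L = - 3\<close>.\<close>

lemma bij_stair_value_2_iff: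
  assumes "0 < h" "h < a" "coprime h a" "0 < t"
  shows "(\<exists>L D. bij_betw (stair_value t 2 L D) (stair_region a h t) {0..}) \<longleftrightarrow>
    t = 4 \<and> 2 * h = a + 1"
proof -
  interpret stair_tiling a h t 2 L D for L D using assms by unfold_locales auto
  have range: "{0..<2::int} = {0, 1}" by auto
  have start: "start L D 0 = D" "start L D 1 = L + 2 + D" for L D
    using low_eqI[of 0 0] low_eqI[of 1 1] a_gt h_pos h_less
    by (simp_all add: start_def stair_value_def)
  show ?thesis
  proof
    assume "\<exists>L D. bij_betw (stair_value t 2 L D) (stair_region a h t) {0..}"
    then obtain L D M where M: "a * M = 1 - 2 * h" "2 * M = t + 2 * L"
      and starts: "start L D ` {0, 1} = {0, 1}"
      unfolding bij_iff_starts range by auto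
    have "M < 0" using M assms a_gt by (smt (verit) mult_nonneg_nonneg)
    moreover have "- 2 < M"
    proof (rule ccontr)
      assume "\<not> - 2 < M"
      then have "a * M \<le> a * (- 2)" using a_gt by (intro mult_left_mono) auto
      then show False using M h_less by simp
    qed
    ultimately have "M = - 1" by simp
    then show "t = 4 \<and> 2 * h = a + 1"
      using M starts t_pos by (auto simp: start doubleton_eq_iff)
  next
    assume "t = 4 \<and> 2 * h = a + 1"
    then have "a * (- 1) = 1 - 2 * h \<and> 2 * (- 1) = t * (2 - 1) + 2 * (- 3)" by simp
    moreover have "start (- 3) 1 ` {0, 1} = {0, 1}"
      unfolding image_insert image_empty start by auto
    ultimately have "bij_betw (stair_value t 2 (- 3) 1) (stair_region a h t) {0..}"
      unfolding bij_iff_starts range by blast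
    then show "\<exists>L D. bij_betw (stair_value t 2 L D) (stair_region a h t) {0..}" by blast
  qed
qed

text \<open>Both \<open>M = - 1\<close> and \<open>M = - 2\<close> occur; the starts of staircases 1
  and 2 merely trade places. In either case \<open>L = M - t\<close>, and the starts are 0, 1, 2 in
  some order only for \<open>t = 3\<close> and \<open>D = 2\<close>.\<close>

lemma bij_stair_value_3_iff:
  assumes "0 < h" "h < a" "coprime h a" "0 < t"
  shows "(\<exists>L D. bij_betw (stair_value t 3 L D) (stair_region a h t) {0..}) \<longleftrightarrow>
    t = 3 \<and> (3 * h = a + 1 \<or> 3 * h = 2 * a + 1)"
proof -
  interpret stair_tiling a h t 3 L D for L D using assms by unfold_locales auto
  have range: "{0..<3::int} = {0, 1, 2}" by auto
  have start: "start L D 0 = D" "start L D 1 = L + 3 + D" for L D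
    using low_eqI[of 0 0] low_eqI[of 1 1] a_gt h_pos h_less
    by (simp_all add: start_def stair_value_def)
  have start2: "start L D 2 = (if 2 * h \<le> a then t + 2 * L + 3 + D else t + 2 * L + 6 + D)" for L D
    using low_eqI[of 2 1] low_eqI[of 2 2] a_gt h_pos h_less
    by (simp add: start_def stair_value_def)
  show ?thesis
  proof
    assume "\<exists>L D. bij_betw (stair_value t 3 L D) (stair_region a h t) {0..}"
    then obtain L D M where M: "a * M = 1 - 3 * h" "2 * M = t * 2 + 2 * L"
      and starts: "start L D ` {0, 1, 2} = {0, 1, 2}"
      unfolding bij_iff_starts range by auto
    have "M < 0" using M assms a_gt by (smt (verit) mult_nonneg_nonneg)
    moreover have "- 3 < M"
    proof (rule ccontr)
      assume "\<not> - 3 < M"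
      then have "a * M \<le> a * (- 3)" using a_gt by (intro mult_left_mono) auto
      then show False using M h_less by simp
    qed
    ultimately consider "M = - 1" | "M = - 2" by linarith
    then have *: "start L D ` {0, 1, 2} = {D, D + 1 - t, D + 2 - t} \<and> (3 * h = a + 1 \<or> 3 * h = 2 * a + 1)"
      using M h_pos h_less by cases (auto simp: start start2)
    then have eq: "{D, D + 1 - t, D + 2 - t} = {0, 1, 2}" using starts by simp
    have "card {D, D + 1 - t, D + 2 - t} = 3" unfolding eq by simp
    then have "D \<noteq> D + 1 - t" "D \<noteq> D + 2 - t" by (auto simp: card_insert_if split: if_splits)
    moreover have "D \<in> {0, 1, 2}" "D + 1 - t \<in> {0, 1, 2}" "D + 2 - t \<in> {0, 1, 2}"
      unfolding eq[symmetric] by simp_all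
    then have "0 \<le> D + 1 - t" "D \<le> 2" by auto
    ultimately have "t = 3" using t_pos by linarith
    then show "t = 3 \<and> (3 * h = a + 1 \<or> 3 * h = 2 * a + 1)" using * by simp
  next
    assume t: "t = 3 \<and> (3 * h = a + 1 \<or> 3 * h = 2 * a + 1)"
    then consider "3 * h = a + 1" | "3 * h = 2 * a + 1" by blast
    then have "\<exists>L. bij_betw (stair_value t 3 L 2) (stair_region a h t) {0..}"
    proof cases
      case 1
      then have "a * (- 1) = 1 - 3 * h \<and> 2 * (- 1) = t * (3 - 1) + 2 * (- 4)" using t by simp
      moreover have "start (- 4) 2 ` {0, 1, 2} = {0, 1, 2}"
        unfolding image_insert image_empty start start2 using t 1 h_less h_pos by auto
      ultimately have "bij_betw (stair_value t 3 (- 4) 2) (stair_region a h t) {0..}"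
        unfolding bij_iff_starts range by blast
      then show ?thesis ..
    next
      case 2
      then have "a * (- 2) = 1 - 3 * h \<and> 2 * (- 2) = t * (3 - 1) + 2 * (- 5)" using t by simp
      moreover have "start (- 5) 2 ` {0, 1, 2} = {0, 1, 2}"
        unfolding image_insert image_empty start start2 using t 2 h_less h_pos by auto
      ultimately have "bij_betw (stair_value t 3 (- 5) 2) (stair_region a h t) {0..}"
        unfolding bij_iff_starts range by blast
      then show ?thesis ..
    qed
    then show "\<exists>L D. bij_betw (stair_value t 3 L D) (stair_region a h t) {0..}" by blast
  qed
qed

text \<open>Parity leaves \<open>M = - 1\<close> and \<open>M = - 3\<close>. With
  \<open>t = 2 * s\<close>, staircases 1 and 3 start at \<open>D + 3 - 3 * s\<close> and
  \<open>D + 1 - 3 * s\<close> in one of the two orders. The range \<open>0..<4\<close> forces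
  \<open>s = 1\<close>, and then one of them starts at \<open>D\<close>, like staircase 0.\<close>

lemma not_bij_stair_value_4:
  assumes "0 < h" "h < a" "coprime h a" "0 < t"
  shows "\<not> bij_betw (stair_value t 4 L D) (stair_region a h t) {0..}"
proof
  interpret stair_tiling a h t 4 L D using assms by unfold_locales auto
  assume "bij_betw (stair_value t 4 L D) (stair_region a h t) {0..}"
  then obtain M where M: "a * M = 1 - 4 * h" "2 * M = t * 3 + 2 * L"
    and starts: "start ` {0..<4} = {0..<4}"
    unfolding bij_iff_starts by auto
  have "M < 0" using M assms a_gt by (smt (verit) mult_nonneg_nonneg)
  moreover have "- 4 < M"
  proof (rule ccontr)
    assume "\<not> - 4 < M"
    then have "a * M \<le> a * (- 4)" using a_gt by (intro mult_left_mono) auto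
    then show False using M h_less by simp
  qed
  moreover have "M \<noteq> - 2"
  proof
    assume "M = - 2"
    then have "- (2 * a) = 1 - 4 * h" using M by simp
    then show False by presburger
  qed
  ultimately have cases: "M = - 1 \<or> M = - 3" by linarith
  have start: "start 0 = D" "start 1 = L + 4 + D" "start 3 = 3 * t + 3 * L + 4 * low 3 + D"
    using low_eqI[of 0 0] low_eqI[of 1 1] a_gt h_pos h_less
    by (simp_all add: start_def stair_value_def)
  have "even t" using M(2) by presburger
  then obtain s where s: "t = 2 * s" ..
  then have L: "L = M - 3 * s" using M(2) by simp
  from cases have low: "low 3 = - M"
  proof
    assume "M = - 1"
    then show ?thesis using M(1) low_eqI[of 3 1] h_pos h_less by simp
  next
    assume "M = - 3"
    then show ?thesis using M(1) low_eqI[of 3 3] h_pos h_less by simp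
  qed
  have "start 0 \<in> {0..<4}" "start 1 \<in> {0..<4}" "start 3 \<in> {0..<4}" using starts by auto
  moreover have "inj_on start {0..<4}" using starts by (intro eq_card_imp_inj_on) auto
  then have "start 0 \<noteq> start 1" "start 0 \<noteq> start 3" by (auto dest: inj_onD)
  moreover have "start 0 = D" "start 1 = D + 4 + M - 3 * s" "start 3 = D - M - 3 * s"
    unfolding start low using L s by linarith+
  ultimately have vals: "0 \<le> D" "D < 4" "0 \<le> D + 4 + M - 3 * s" "D + 4 + M - 3 * s < 4"
    "0 \<le> D - M - 3 * s" "D \<noteq> D + 4 + M - 3 * s" "D \<noteq> D - M - 3 * s" "0 < s"
    using t_pos s by simp_all
  from cases show False
  proof
    assume "M = - 1"
    then show False using vals by presburger
  next
    assume "M = - 3"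
    then show False using vals by presburger
  qed
qed

section \<open>The shape of stair polynomials\<close>

lemma coeff_homogeneous_part:
  "coeff (coeff (homogeneous_part d p) j) i = (if i + j = d then coeff (coeff p j) i else 0)"
proof -
  have y: "var_y ^ j = monom 1 j" for j
    unfolding var_y_def by (induction j) (simp_all add: monom_Suc)
  have x: "var_x ^ i = [:monom 1 i:]" for i
    unfolding var_x_def by (induction i) (simp_all add: monom_Suc one_pCons)
  have "const2 c * var_x ^ i * var_y ^ j = monom (monom c i) j" for c i j
    unfolding x y const2_def by (simp add: smult_monom)
  \<comment> \<open>The truncated difference \<open>d - j'\<close> is exact because the sum runs
    over \<open>j'\<close> up to \<open>d\<close>.\<close>
  then have "coeff (coeff (homogeneous_part d p) j) i =
      (\<Sum>j'\<le>d. if j' = j then (if d - j' = i then coeff (coeff p j') (d - j') else 0) else 0)"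
    unfolding homogeneous_part_def coeff_sum by (intro sum.cong) auto
  then show ?thesis by (auto simp: sum.delta)
qed

text \<open>The polynomial \<open>c (x - q y)^2 + A x + B y + D\<close>, expanded into nested
  coefficient lists.\<close>

definition shear_square :: "real \<Rightarrow> real \<Rightarrow> real \<Rightarrow> real \<Rightarrow> real \<Rightarrow> real poly poly"
  where "shear_square c q A B D = [:[:D, A, c:], [:B, - 2 * c * q:], [:c * q\<^sup>2:]:]"

lemma eval2_shear_square:
  "eval2 (shear_square c q A B D) (x, y) = c * (x - q * y)\<^sup>2 + A * x + B * y + D"
  by (simp add: eval2_def shear_square_def algebra_simps power2_eq_square)

lemma shear_square_iff:
  "homogeneous_part 2 p = const2 c * (var_x - const2 q * var_y)\<^sup>2 \<and> (\<forall>d>2. homogeneous_part d p = 0)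
    \<longleftrightarrow> (\<exists>A B D. p = shear_square c q A B D)"
  (is "?L \<longleftrightarrow> ?R")
proof -
  have rhs: "const2 c * (var_x - const2 q * var_y)\<^sup>2 = [:[:0, 0, c:], [:0, - 2 * c * q:], [:c * q\<^sup>2:]:]"
    by (simp add: const2_def var_x_def var_y_def power2_eq_square algebra_simps)
  have coeffs: "coeff (coeff (shear_square c q A B D) j) i =
     (if i + j = 2 then coeff (coeff [:[:0, 0, c:], [:0, - 2 * c * q:], [:c * q\<^sup>2:]:] j) i
      else if i + j > 2 then 0 else if j = 1 then B else if i = 1 then A else D)" for i j A B D
    by (auto simp: shear_square_def coeff_pCons split: nat.splits)
  show ?thesis
  proof
    assume L: ?L
    have big: "coeff (coeff p j) i = 0" if "i + j > 2" for i j
      using L that coeff_homogeneous_part[of "i + j" p j i] by simp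
    have two: "coeff (coeff p j) i = coeff (coeff [:[:0, 0, c:], [:0, - 2 * c * q:], [:c * q\<^sup>2:]:] j) i"
      if "i + j = 2" for i j
      using L that coeff_homogeneous_part[of 2 p j i] rhs by simp
    have "coeff (coeff p j) i = coeff (coeff (shear_square c q (coeff (coeff p 0) 1)
        (coeff (coeff p 1) 0) (coeff (coeff p 0) 0)) j) i" for i j
    proof -
      consider "i + j = 2" | "i + j > 2" | "i = 0 \<and> j = 0" | "i = 1 \<and> j = 0" | "i = 0 \<and> j = 1"
        by linarith
      then show ?thesis
        by cases (simp_all add: coeffs two big del: coeff_pCons)
    qed
    then have "p = shear_square c q (coeff (coeff p 0) 1) (coeff (coeff p 1) 0) (coeff (coeff p 0) 0)"
      by (intro poly_eqI) blast
    then show ?R by blast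
  next
    assume ?R
    then obtain A B D where p: "p = shear_square c q A B D" by blast
    show ?L unfolding rhs
      by (intro conjI allI impI poly_eqI)
        (simp_all add: p coeff_homogeneous_part coeffs, auto simp: coeff_pCons split: nat.splits)
  qed
qed

text \<open>The nonvanishing demanded by \<open>quadratic2\<close> comes from the coefficient
  \<open>n / 2\<close> of \<open>x^2\<close>.\<close>

lemma stair_polynomial_shape:
  assumes "n > 0"
  shows "quadratic2 p \<and> homogeneous_part 2 p = const2 (real_of_int n / 2) *
      (var_x - const2 (real_of_int (m - 1) / real_of_int n) * var_y) ^ 2 \<longleftrightarrow>
    (\<exists>A B D. p = shear_square (real_of_int n / 2) (real_of_int (m - 1) / real_of_int n) A B D)"
proof -
  have "homogeneous_part 2 (shear_square (real_of_int n / 2) q A B D) \<noteq> 0" for q A B D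
  proof
    assume "homogeneous_part 2 (shear_square (real_of_int n / 2) q A B D) = 0"
    then have "coeff (coeff (homogeneous_part 2 (shear_square (real_of_int n / 2) q A B D)) 0) 2 = 0"
      by simp
    then show False
      using assms by (simp add: coeff_homogeneous_part shear_square_def numeral_2_eq_2)
  qed
  then show ?thesis
    unfolding quadratic2_def shear_square_iff[symmetric] by (metis shear_square_iff)
qed

text \<open>The second difference of an integer-valued \<open>p\<close> along the
  \<open>y\<close>-axis is an integer, and it equals \<open>(m - 1)^2 / n\<close>.\<close>

lemma stair_polynomial_dvd:
  assumes "n > 0" "stair_polynomial k n m p"
  shows "n dvd (m - 1)\<^sup>2"
proof -
  obtain A B D where p: "p = shear_square (real_of_int n / 2) (real_of_int (m - 1) / real_of_int n) A B D"
    using assms stair_polynomial_shape[OF assms(1)] unfolding stair_polynomial_def by metis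
  have "eval2 p (0, y) \<in> \<int>" if "y \<in> \<int>" for y
    using assms(2) that unfolding stair_polynomial_def int_lattice_def by auto
  then have "eval2 p (0, 2) - 2 * eval2 p (0, 1) + eval2 p (0, 0) \<in> \<int>"
    by (intro Ints_add Ints_diff Ints_mult) auto
  also have "eval2 p (0, 2) - 2 * eval2 p (0, 1) + eval2 p (0, 0) = real_of_int ((m - 1)\<^sup>2) / real_of_int n"
    using assms(1) by (simp add: p eval2_shear_square power2_eq_square field_simps)
  finally obtain z where "real_of_int ((m - 1)\<^sup>2) / real_of_int n = real_of_int z" by (elim Ints_cases)
  then have "real_of_int ((m - 1)\<^sup>2) = real_of_int (n * z)" using assms(1) by (simp add: field_simps)
  then have "(m - 1)\<^sup>2 = n * z" by linarith
  then show ?thesis by simp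
qed

section \<open>Lattice coordinates adapted to the staircases\<close>

locale stair_lattice =
  fixes a b h g t n m :: int
  assumes bezout: "a * g + b * h = 1"
    and h_pos: "0 < h" and h_less: "h < a" and b_pos: "0 < b" and b_less: "b < a" and t_pos: "0 < t"
    and n_eq: "n = a\<^sup>2 * t" and m_eq: "m = a * b * t + 1"
begin

lemma a_pos: "0 < a" using h_pos h_less by simp

lemma n_pos: "0 < n" and m_pos: "0 < m"
  using a_pos b_pos t_pos by (simp_all add: n_eq m_eq add_pos_pos)

lemma coprime_ha: "coprime h a"
proof (rule coprimeI)
  fix c assume "c dvd h" "c dvd a"
  then have "c dvd a * g + b * h" by simp
  then show "is_unit c" using bezout by simp
qed

lemma gcd_eq: "gcd n (m - 1) = a * t"
proof -
  have "coprime a b"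
  proof (rule coprimeI)
    fix c assume "c dvd a" "c dvd b"
    then have "c dvd a * g + b * h" by simp
    then show "is_unit c" using bezout by simp
  qed
  moreover have "gcd n (m - 1) = gcd (a * t * a) (a * t * b)"
    by (simp add: n_eq m_eq power2_eq_square ac_simps)
  ultimately show ?thesis
    using a_pos t_pos by (simp only: gcd_mult_left) (simp add: normalize_mult)
qed

text \<open>The inverse of the map sending \<open>(x, y)\<close> to
  \<open>(a x - b y, h x + g y)\<close>, which has determinant \<open>a g + b h = 1\<close> and so
  preserves the integer lattice.\<close>

definition point :: "int \<times> int \<Rightarrow> real \<times> real"
  where "point = (\<lambda>(u, v). (real_of_int (u * g + v * b), real_of_int (v * a - u * h)))"

lemma point_simp: "point (u, v) = (real_of_int (u * g + v * b), real_of_int (v * a - u * h))"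
  by (simp add: point_def)

lemma coords:
  "a * (u * g + v * b) - b * (v * a - u * h) = u"
  "h * (u * g + v * b) + g * (v * a - u * h) = v"
proof -
  have "a * (u * g + v * b) - b * (v * a - u * h) = (a * g + b * h) * u"
    "h * (u * g + v * b) + g * (v * a - u * h) = (a * g + b * h) * v" by (simp_all add: algebra_simps)
  then show "a * (u * g + v * b) - b * (v * a - u * h) = u"
    "h * (u * g + v * b) + g * (v * a - u * h) = v" using bezout by simp_all
qed

lemma inj_point: "inj point"
proof (rule injI)
  fix p q assume "point p = point q"
  then show "p = q"
    by (cases p; cases q) (simp add: point_simp del: of_int_add of_int_mult of_int_diff,
        metis coords)
qed

lemma range_point: "range point = int_lattice"
proof
  show "range point \<subseteq> int_lattice" by (auto simp: point_def int_lattice_def)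
  show "int_lattice \<subseteq> range point"
  proof
    fix p assume "p \<in> int_lattice"
    then obtain x y :: int where p: "p = (of_int x, of_int y)"
      by (auto simp: int_lattice_def elim!: Ints_cases)
    have "(a * x - b * y) * g + (h * x + g * y) * b = (a * g + b * h) * x"
      "(h * x + g * y) * a - (a * x - b * y) * h = (a * g + b * h) * y"
      by (simp_all add: algebra_simps)
    then have "p = point (a * x - b * y, h * x + g * y)" unfolding point_simp p bezout by simp
    then show "p \<in> range point" by blast
  qed
qed

text \<open>Substituting \<open>n\<close> and \<open>m\<close> turns \<open>m y \<le> n x\<close>
  into a bound on \<open>y\<close> by \<open>a t\<close> times the first lattice coordinate;
  \<open>x \<ge> 0\<close> follows from the other two inequalities.\<close>

lemma sector_iff:
  "(x, y) \<in> sector (real_of_int n / real_of_int m) \<longleftrightarrow>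
    0 \<le> y \<and> y \<le> real_of_int (a * t) * (real_of_int a * x - real_of_int b * y)"
proof -
  have "y \<le> real_of_int n / real_of_int m * x \<longleftrightarrow> real_of_int m * y \<le> real_of_int n * x"
    using m_pos by (simp add: field_simps)
  also have "\<dots> \<longleftrightarrow> y \<le> real_of_int (a * t) * (real_of_int a * x - real_of_int b * y)"
    by (simp add: n_eq m_eq algebra_simps power2_eq_square)
  finally have *: "y \<le> real_of_int n / real_of_int m * x \<longleftrightarrow>
    y \<le> real_of_int (a * t) * (real_of_int a * x - real_of_int b * y)" .
  have "0 \<le> x" if "0 \<le> y" "y \<le> real_of_int n / real_of_int m * x"
  proof -
    have "0 \<le> real_of_int n / real_of_int m * x" using that by linarith
    then show ?thesis using n_pos m_pos by (simp add: zero_le_mult_iff zero_le_divide_iff)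
  qed
  then show ?thesis unfolding sector_def using * by auto
qed

lemma point_coord: "point (u, v) = (x, y) \<Longrightarrow> real_of_int a * x - real_of_int b * y = real_of_int u"
proof -
  assume "point (u, v) = (x, y)"
  then have "real_of_int a * x - real_of_int b * y =
      real_of_int (a * (u * g + v * b) - b * (v * a - u * h))" by (auto simp: point_simp)
  then show ?thesis unfolding coords .
qed

lemma point_in_sector:
  "point p \<in> sector (real_of_int n / real_of_int m) \<longleftrightarrow> p \<in> stair_region a h t"
proof (cases p)
  case (Pair u v)
  have "point p \<in> sector (real_of_int n / real_of_int m) \<longleftrightarrow>
    0 \<le> real_of_int (v * a - u * h) \<and> real_of_int (v * a - u * h) \<le> real_of_int (a * t) * real_of_int u"
    using point_coord[of u v "fst (point p)" "snd (point p)"]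
      sector_iff[of "fst (point p)" "snd (point p)"] by (simp add: Pair point_simp)
  also have "\<dots> \<longleftrightarrow> 0 \<le> v * a - u * h \<and> v * a - u * h \<le> a * t * u"
    by (simp only: of_int_mult[symmetric] of_int_le_iff of_int_0_le_iff)
  also have "\<dots> \<longleftrightarrow> u * h \<le> a * v \<and> a * v \<le> a * t * u + u * h"
    by (auto simp: algebra_simps)
  also have "\<dots> \<longleftrightarrow> p \<in> stair_region a h t"
  proof -
    have "0 \<le> u" if "u * h \<le> a * v" "a * v \<le> a * t * u + u * h"
    proof -
      have "0 \<le> a * t * u" using that by linarith
      moreover have "0 < a * t" using a_pos t_pos by simp
      ultimately show ?thesis by (metis mult_pos_neg not_less)
    qed
    then show ?thesis by (auto simp: stair_region_def Pair)
  qed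
  finally show ?thesis .
qed

lemma bij_point: "bij_betw point (stair_region a h t) (int_sector (real_of_int n / real_of_int m))"
proof -
  have "point ` stair_region a h t = int_sector (real_of_int n / real_of_int m)"
    unfolding int_sector_def range_point[symmetric] using point_in_sector by auto
  then show ?thesis using inj_point by (auto simp: bij_betw_def intro: inj_on_subset)
qed

text \<open>Since \<open>n x - (m - 1) y = a t (a x - b y)\<close> and the gcd is
  \<open>a t\<close>, the staircase number is the coordinate \<open>u\<close>.\<close>

lemma point_in_staircase:
  "point (u, v) \<in> staircase n m c \<longleftrightarrow> (u, v) \<in> stair_region a h t \<and> u = int c"
proof -
  obtain x y where xy: "point (u, v) = (x, y)" by (cases "point (u, v)")
  have at: "real_of_int a * real_of_int t \<noteq> 0" using a_pos t_pos by simp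
  have "real_of_int n * x - real_of_int (m - 1) * y =
      (real_of_int a * x - real_of_int b * y) * (real_of_int a * real_of_int t)"
    by (simp add: n_eq m_eq algebra_simps power2_eq_square)
  then have "real_of_int n * x - real_of_int (m - 1) * y = real c * real_of_int (gcd n (m - 1)) \<longleftrightarrow>
      real_of_int u = real c"
    unfolding gcd_eq of_int_mult point_coord[OF xy] using at by simp
  then show ?thesis
    unfolding staircase_def xy using point_in_sector[of "(u, v)"] by (auto simp: xy)
qed

lemma stairs_eq: "stairs n m = point ` stair_region a h t"
proof -
  have "\<exists>c. point p \<in> staircase n m c" if "p \<in> stair_region a h t" for p
    using that point_in_staircase[of "fst p" "snd p" "nat (fst p)"]
    by (cases p) (auto simp: stair_region_def)
  moreover have "p \<in> stair_region a h t" if "point p \<in> staircase n m c" for p c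
    using that point_in_staircase[of "fst p" "snd p"] by (cases p) auto
  ultimately show ?thesis
    unfolding stairs_def range_point[symmetric] by auto
qed

lemma point_in_segment:
  assumes "v < w"
  shows "point (u', z) \<in> closed_segment (point (u, v)) (point (u, w)) \<longleftrightarrow> u' = u \<and> v \<le> z \<and> z \<le> w"
proof
  assume "point (u', z) \<in> closed_segment (point (u, v)) (point (u, w))"
  then obtain \<theta> where \<theta>: "0 \<le> \<theta>" "\<theta> \<le> 1"
    and eq: "point (u', z) = (1 - \<theta>) *\<^sub>R point (u, v) + \<theta> *\<^sub>R point (u, w)"
    by (auto simp: in_segment)
  have eq1: "real_of_int (u' * g + z * b) =
      (1 - \<theta>) * real_of_int (u * g + v * b) + \<theta> * real_of_int (u * g + w * b)"
    and eq2: "real_of_int (z * a - u' * h) =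
      (1 - \<theta>) * real_of_int (v * a - u * h) + \<theta> * real_of_int (w * a - u * h)"
    using eq by (simp_all add: point_simp)
  \<comment> \<open>The linear form \<open>a x - b y\<close>, and then \<open>h x + g y\<close>, is
    applied to the convex combination to recover the two coordinates.\<close>
  have "real_of_int (a * (u' * g + z * b) - b * (z * a - u' * h)) =
    (1 - \<theta>) * real_of_int (a * (u * g + v * b) - b * (v * a - u * h)) +
    \<theta> * real_of_int (a * (u * g + w * b) - b * (w * a - u * h))"
    unfolding of_int_diff of_int_mult[of a] of_int_mult[of b] eq1 eq2[unfolded of_int_diff]
    by (simp add: algebra_simps)
  then have "real_of_int u' = real_of_int u" unfolding coords by (simp add: algebra_simps)
  moreover have "real_of_int (h * (u' * g + z * b) + g * (z * a - u' * h)) =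
    (1 - \<theta>) * real_of_int (h * (u * g + v * b) + g * (v * a - u * h)) +
    \<theta> * real_of_int (h * (u * g + w * b) + g * (w * a - u * h))"
    unfolding of_int_add[of "h * _"] of_int_mult[of h] of_int_mult[of g] eq1 eq2
    by (simp add: algebra_simps)
  then have "real_of_int z = real_of_int v + \<theta> * real_of_int (w - v)"
    unfolding coords by (simp add: algebra_simps)
  moreover have "0 \<le> \<theta> * real_of_int (w - v)" "\<theta> * real_of_int (w - v) \<le> real_of_int (w - v)"
    using \<theta> assms by (simp_all add: mult_left_le_one_le)
  ultimately show "u' = u \<and> v \<le> z \<and> z \<le> w" by linarith
next
  assume z: "u' = u \<and> v \<le> z \<and> z \<le> w"
  define \<theta> where "\<theta> = real_of_int (z - v) / real_of_int (w - v)"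
  have "0 \<le> \<theta>" "\<theta> \<le> 1" using z assms by (simp_all add: \<theta>_def)
  moreover have "\<theta> * real_of_int (w - v) = real_of_int (z - v)" using assms by (simp add: \<theta>_def)
  then have zeq: "real_of_int z = real_of_int v + \<theta> * (real_of_int w - real_of_int v)" by simp
  then have "point (u', z) = (1 - \<theta>) *\<^sub>R point (u, v) + \<theta> *\<^sub>R point (u, w)"
    using z by (simp add: point_simp zeq) (simp add: algebra_simps)
  ultimately show "point (u', z) \<in> closed_segment (point (u, v)) (point (u, w))"
    by (auto simp: in_segment)
qed

lemma consecutive_points:
  assumes "(u, v) \<in> stair_region a h t" "(u, v + 1) \<in> stair_region a h t"
  shows "consecutive_stairs n m (point (u, v)) (point (u, v + 1))"
proof -
  have "u \<ge> 0" using assms by (simp add: stair_region_def)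
  then have "point (u, v) \<in> staircase n m (nat u)" "point (u, v + 1) \<in> staircase n m (nat u)"
    using assms by (simp_all add: point_in_staircase)
  moreover have "closed_segment (point (u, v)) (point (u, v + 1)) \<inter> stairs n m =
      {point (u, v), point (u, v + 1)}"
  proof -
    have "p = (u, v) \<or> p = (u, v + 1)"
      if "point p \<in> closed_segment (point (u, v)) (point (u, v + 1))" for p
      using that point_in_segment[of v "v + 1" "fst p" "snd p" u] by (cases p) auto
    then show ?thesis unfolding stairs_eq using assms ends_in_segment by blast
  qed
  moreover have "point (u, v) \<noteq> point (u, v + 1)" using inj_point by (auto dest: injD)
  ultimately show ?thesis unfolding consecutive_stairs_def using assms by (auto simp: stairs_eq)
qed

text \<open>Each staircase is an interval in \<open>v\<close>; a gap larger than one would leave the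
  stair at \<open>v + 1\<close> strictly between the two.\<close>

lemma consecutive_stairsE:
  assumes "consecutive_stairs n m r s"
  obtains u v where "(u, v) \<in> stair_region a h t" "(u, v + 1) \<in> stair_region a h t"
    "r = point (u, v) \<and> s = point (u, v + 1) \<or> s = point (u, v) \<and> r = point (u, v + 1)"
proof -
  have *: "\<exists>u v. (u, v) \<in> stair_region a h t \<and> (u, v + 1) \<in> stair_region a h t \<and>
      r = point (u, v) \<and> s = point (u, v + 1)"
    if rs: "r = point (u, v)" "s = point (u, w)" "v < w"
      and reg: "(u, v) \<in> stair_region a h t" "(u, w) \<in> stair_region a h t"
      and seg: "closed_segment r s \<inter> stairs n m = {r, s}" for r s u v w
  proof -
    have "a * v \<le> a * (v + 1)" "a * (v + 1) \<le> a * w"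
      using rs(3) a_pos by (intro mult_left_mono; simp)+
    then have "(u, v + 1) \<in> stair_region a h t"
      using reg unfolding stair_region_def by simp
    moreover from this have "point (u, v + 1) \<in> closed_segment r s \<inter> stairs n m"
      using point_in_segment[OF rs(3), of u "v + 1" u] rs(3) unfolding stairs_eq rs(1,2) by simp
    then have "point (u, v + 1) \<in> {r, s}" unfolding seg .
    then have "w = v + 1" unfolding rs by (simp add: inj_eq[OF inj_point])
    ultimately show ?thesis using rs(1,2) reg by blast
  qed
  have ne: "r \<noteq> s" and seg: "closed_segment r s \<inter> stairs n m = {r, s}"
    and rs: "r \<in> point ` stair_region a h t" "s \<in> point ` stair_region a h t"
    and "\<exists>c. r \<in> staircase n m c \<and> s \<in> staircase n m c"
    using assms unfolding consecutive_stairs_def stairs_eq by simp_all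
  then obtain c where c: "r \<in> staircase n m c" "s \<in> staircase n m c" by blast
  obtain u v where r: "r = point (u, v)" using rs(1) by auto
  obtain u' w where s: "s = point (u', w)" using rs(2) by auto
  have "u' = u" and reg: "(u, v) \<in> stair_region a h t" "(u, w) \<in> stair_region a h t"
    using c unfolding r s point_in_staircase by auto
  then have rs: "r = point (u, v)" "s = point (u, w)" "v \<noteq> w" using r s ne by auto
  show thesis
  proof (cases "v < w")
    case True
    from *[OF rs(1,2) this reg seg] show thesis using that by metis
  next
    case False
    then have "w < v" using rs by simp
    moreover have "closed_segment s r \<inter> stairs n m = {s, r}"
      using seg by (simp add: closed_segment_commute insert_commute)
    ultimately have "\<exists>u v. (u, v) \<in> stair_region a h t \<and> (u, v + 1) \<in> stair_region a h t \<and>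
      s = point (u, v) \<and> r = point (u, v + 1)" by (intro *[OF rs(2,1) _ reg(2,1)])
    then show thesis using that by metis
  qed
qed

text \<open>Raising \<open>v\<close> by one adds the positive vector \<open>(b, a)\<close> to a
  point of the first quadrant, so ascending means increasing in \<open>v\<close>.\<close>

lemma norm_point_less:
  assumes "(u, v) \<in> stair_region a h t"
  shows "norm (point (u, v)) < norm (point (u, v + 1))"
proof -
  obtain x y where xy: "point (u, v) = (x, y)" by (cases "point (u, v)")
  then have "(x, y) \<in> sector (real_of_int n / real_of_int m)" using assms point_in_sector by metis
  then have "0 \<le> x" "0 \<le> y" by (auto simp: sector_def)
  moreover have next_point: "point (u, v + 1) = (x + real_of_int b, y + real_of_int a)"
    using xy by (auto simp: point_simp algebra_simps)
  moreover have "x\<^sup>2 < (x + real_of_int b)\<^sup>2" "y\<^sup>2 < (y + real_of_int a)\<^sup>2"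
    using calculation a_pos b_pos by (intro power_strict_mono; simp)+
  ultimately show ?thesis unfolding xy next_point norm_Pair real_sqrt_less_iff by simp
qed

text \<open>
  The linear coefficients solve \<open>A g - B h = L - t / 2\<close> and \<open>A b + B a = K\<close>.
\<close>

definition stair_poly :: "int \<Rightarrow> int \<Rightarrow> int \<Rightarrow> real poly poly"
  where "stair_poly K L D = shear_square (real_of_int n / 2) (real_of_int (m - 1) / real_of_int n)
    (real_of_int a * (real_of_int L - real_of_int t / 2) + real_of_int h * real_of_int K)
    (real_of_int g * real_of_int K - real_of_int b * (real_of_int L - real_of_int t / 2))
    (real_of_int D)"

text \<open>The quadratic part equals \<open>t / 2\<close> times \<open>(a x - b y)^2\<close>, and
  \<open>a x - b y = u\<close>.\<close>

lemma eval2_shear_square_point: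
  "eval2 (shear_square (real_of_int n / 2) (real_of_int (m - 1) / real_of_int n) A B D) (point (u, v)) =
    real_of_int t / 2 * (real_of_int u)\<^sup>2 + (A * g - B * h) * u + (A * b + B * a) * v + D"
proof -
  obtain x y where xy: "point (u, v) = (x, y)" by (cases "point (u, v)")
  have q: "real_of_int (m - 1) / real_of_int n = real_of_int b / real_of_int a"
    using a_pos t_pos by (simp add: n_eq m_eq power2_eq_square)
  have "real_of_int n / 2 * (x - real_of_int b / real_of_int a * y)\<^sup>2 =
    real_of_int t / 2 * (real_of_int a * (x - real_of_int b / real_of_int a * y))\<^sup>2"
    by (simp add: n_eq power_mult_distrib)
  also have "real_of_int a * (x - real_of_int b / real_of_int a * y) = real_of_int u"
    using point_coord[OF xy] a_pos by (simp add: right_diff_distrib)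
  finally have "eval2 (shear_square (real_of_int n / 2) (real_of_int (m - 1) / real_of_int n) A B D) (x, y) =
    real_of_int t / 2 * (real_of_int u)\<^sup>2 + A * x + B * y + D"
    unfolding eval2_shear_square q by simp
  moreover have "A * x + B * y = (A * g - B * h) * u + (A * b + B * a) * v"
    using xy by (auto simp: point_simp algebra_simps)
  ultimately show ?thesis unfolding xy by linarith
qed

lemma bezout_real: "real_of_int a * real_of_int g + real_of_int b * real_of_int h = 1"
  using bezout by (metis of_int_1 of_int_add of_int_mult)

lemma eval2_stair_poly: "eval2 (stair_poly K L D) (point p) = real_of_int (stair_value t K L D p)"
proof (cases p)
  case (Pair u v)
  have "2 * real_of_int (u * (u - 1) div 2) = real_of_int u * (real_of_int u - 1)"
    using arg_cong[OF two_triangle[of u], of real_of_int]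
    by (simp only: of_int_mult of_int_diff of_int_numeral of_int_1)
  then have tri: "real_of_int (u * (u - 1) div 2) = (real_of_int u * real_of_int u - real_of_int u) / 2"
    unfolding right_diff_distrib by simp
  define A where "A = real_of_int a * (real_of_int L - real_of_int t / 2) + real_of_int h * real_of_int K"
  define B where "B = real_of_int g * real_of_int K - real_of_int b * (real_of_int L - real_of_int t / 2)"
  have "A * g - B * h = (real_of_int a * g + real_of_int b * h) * (real_of_int L - real_of_int t / 2)"
    "A * b + B * a = (real_of_int a * g + real_of_int b * h) * real_of_int K"
    unfolding A_def B_def by (simp_all add: algebra_simps)
  then have AB: "A * g - B * h = real_of_int L - real_of_int t / 2" "A * b + B * a = real_of_int K"
    by (simp_all add: bezout_real)
  then show ?thesis
    unfolding Pair stair_poly_def A_def[symmetric] B_def[symmetric] eval2_shear_square_point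
      AB stair_value_def prod.case of_int_add of_int_mult[of t] tri
    by (simp add: power2_eq_square algebra_simps diff_divide_distrib)
qed

lemma stair_value_Suc: "stair_value t K L D (u, v + 1) = stair_value t K L D (u, v) + K"
  by (simp add: stair_value_def algebra_simps)

lemma stair_polynomial_stair_poly:
  "stair_polynomial k n m (stair_poly (int k) L D)"
  "ascending_stair_polynomial k n m (stair_poly (int k) L D)"
proof -
  have "quadratic2 (stair_poly (int k) L D) \<and> homogeneous_part 2 (stair_poly (int k) L D) =
      const2 (real_of_int n / 2) *
      (var_x - const2 (real_of_int (m - 1) / real_of_int n) * var_y) ^ 2"
    unfolding stair_polynomial_shape[OF n_pos] stair_poly_def by blast
  moreover have "eval2 (stair_poly (int k) L D) ` int_lattice \<subseteq> \<int>"
    unfolding range_point[symmetric] by (auto simp: eval2_stair_poly)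
  ultimately show "stair_polynomial k n m (stair_poly (int k) L D)"
    unfolding stair_polynomial_def
    by (auto elim!: consecutive_stairsE simp: eval2_stair_poly stair_value_Suc)
  then show "ascending_stair_polynomial k n m (stair_poly (int k) L D)"
    unfolding ascending_stair_polynomial_def
    using norm_point_less
    by (fastforce elim!: consecutive_stairsE simp: eval2_stair_poly stair_value_Suc)
qed

text \<open>Staircase \<open>a\<close> has at least two stairs, so the condition on consecutive
  stairs is not vacuous and determines \<open>K\<close>.\<close>

lemma consecutive_example:
  "(a, h) \<in> stair_region a h t" "(a, h + 1) \<in> stair_region a h t"
proof -
  have "a * 1 \<le> a * (t * a)" using a_pos t_pos mult_mono[of 1 t 1 a] by (intro mult_left_mono) auto
  then show "(a, h) \<in> stair_region a h t" "(a, h + 1) \<in> stair_region a h t"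
    using a_pos by (simp_all add: stair_region_def algebra_simps)
qed

text \<open>Integrality at \<open>(0, 0)\<close> and \<open>(1, 0)\<close> makes \<open>D\<close>
  and \<open>L\<close> integers; the pair on staircase \<open>a\<close> gives
  \<open>K\<close>.\<close>

lemma stair_polynomialE:
  assumes "stair_polynomial k n m p"
  obtains K L D where "p = stair_poly K L D" "\<bar>K\<bar> = int k"
proof -
  obtain A B D where p: "p = shear_square (real_of_int n / 2) (real_of_int (m - 1) / real_of_int n) A B D"
    using assms stair_polynomial_shape[OF n_pos] unfolding stair_polynomial_def by metis
  note eval = eval2_shear_square_point[of A B D, folded p]
  have int: "eval2 p (point q) \<in> \<int>" for q
    using assms range_point unfolding stair_polynomial_def by blast
  obtain D' where D': "D = real_of_int D'"
    using int[of "(0, 0)"] unfolding eval by (auto elim: Ints_cases)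
  have "eval2 p (point (1, 0)) - eval2 p (point (0, 0)) \<in> \<int>" using int by (intro Ints_diff)
  then obtain L where L: "real_of_int t / 2 + (A * g - B * h) = real_of_int L"
    unfolding eval by (auto elim: Ints_cases)
  have "eval2 p (point (a, h)) - eval2 p (point (a, h + 1)) = - (A * b + B * a)"
    unfolding eval by (simp add: algebra_simps)
  moreover have "eval2 p (point (a, h)) - eval2 p (point (a, h + 1)) \<in> {real k, - real k}"
    using assms consecutive_points[OF consecutive_example] unfolding stair_polynomial_def by blast
  ultimately have "A * b + B * a = real_of_int (int k) \<or> A * b + B * a = real_of_int (- int k)"
    by (auto simp del: minus_add_distrib)
  then obtain K where K: "A * b + B * a = real_of_int K" "\<bar>K\<bar> = int k"
    by (metis abs_minus abs_of_nat)
  \<comment> \<open>The linear system for \<open>A\<close> and \<open>B\<close> is solved by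
    Cramer's rule, with determinant 1.\<close>
  have "A * (real_of_int a * g + real_of_int b * h) = real_of_int a * (A * g - B * h) + h * (A * b + B * a)"
    "B * (real_of_int a * g + real_of_int b * h) = g * (A * b + B * a) - real_of_int b * (A * g - B * h)"
    by (simp_all add: algebra_simps)
  moreover have "A * g - B * h = real_of_int L - real_of_int t / 2" using L by simp
  ultimately have "p = stair_poly K L D'"
    unfolding p stair_poly_def D' bezout_real K(1) by simp
  then show thesis using that K(2) by blast
qed

lemma packing_stair_poly_iff:
  "packing_polynomial (real_of_int n / real_of_int m) (stair_poly K L D) \<longleftrightarrow>
    bij_betw (stair_value t K L D) (stair_region a h t) {0..}"
proof -
  have "packing_polynomial (real_of_int n / real_of_int m) (stair_poly K L D) \<longleftrightarrow>
    bij_betw (eval2 (stair_poly K L D) \<circ> point) (stair_region a h t) \<nat>"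
    unfolding packing_polynomial_def by (rule bij_betw_comp_iff[OF bij_point])
  also have "eval2 (stair_poly K L D) \<circ> point = real_of_int \<circ> stair_value t K L D"
    by (auto simp: eval2_stair_poly)
  also have "bij_betw \<dots> (stair_region a h t) \<nat> \<longleftrightarrow>
      bij_betw (stair_value t K L D) (stair_region a h t) {0..}"
  proof -
    have "real_of_int ` {0..} = \<nat>"
    proof
      show "real_of_int ` {0..} \<subseteq> \<nat>" by (auto simp: of_nat_nat[symmetric] simp del: of_nat_nat)
      show "\<nat> \<subseteq> real_of_int ` {0..}" by (auto elim!: Nats_cases intro!: image_eqI[of _ _ "int _"])
    qed
    moreover have "inj real_of_int" by (simp add: inj_def)
    ultimately have "(real_of_int ` A = \<nat>) = (A = {0..})" for A
      by (metis inj_image_eq_iff)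
    then show ?thesis
      unfolding bij_betw_def image_comp[symmetric] by (simp add: inj_on_def)
  qed
  finally show ?thesis .
qed

end

section \<open>Classification\<close>

text \<open>Reversing every staircase turns descending polynomials into ascending ones.\<close>

lemma bij_stair_value_reflect:
  assumes "bij_betw (stair_value t (- K) L D) (stair_region a h t) {0..}"
  shows "bij_betw (stair_value t K (L - K * t - K) D) (stair_region a (a - h) t) {0..}"
proof -
  \<comment> \<open>An involution reversing each staircase: the lower end \<open>u h / a\<close>
    becomes \<open>u - u h / a\<close>, whence the parameter \<open>a - h\<close>.\<close>
  define \<rho> :: "int \<times> int \<Rightarrow> int \<times> int" where "\<rho> = (\<lambda>(u, v). (u, t * u + u - v))"
  have "bij_betw \<rho> (stair_region a (a - h) t) (stair_region a h t)"
    by (rule bij_betw_byWitness[where f' = \<rho>]) (auto simp: \<rho>_def stair_region_def algebra_simps)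
  then have "bij_betw (stair_value t (- K) L D \<circ> \<rho>) (stair_region a (a - h) t) {0..}"
    using assms by (rule bij_betw_trans)
  moreover have "stair_value t (- K) L D \<circ> \<rho> = stair_value t K (L - K * t - K) D"
    by (auto simp: \<rho>_def stair_value_def fun_eq_iff algebra_simps)
  ultimately show ?thesis by simp
qed

context stair_lattice
begin

lemma ex_ascending_iff:
  "(\<exists>p. ascending_stair_packing_polynomial k n m p) \<longleftrightarrow>
    (\<exists>L D. bij_betw (stair_value t (int k) L D) (stair_region a h t) {0..})"
proof
  assume "\<exists>p. ascending_stair_packing_polynomial k n m p"
  then obtain p where asc: "ascending_stair_polynomial k n m p" and stair: "stair_polynomial k n m p"
    and pack: "packing_polynomial (real_of_int n / real_of_int m) p"
    unfolding ascending_stair_packing_polynomial_def stair_packing_polynomial_def by blast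
  obtain K L D where p: "p = stair_poly K L D" using stair_polynomialE[OF stair] by blast
  have "eval2 p (point (a, h + 1)) - eval2 p (point (a, h)) = real k"
    using asc consecutive_points[OF consecutive_example] norm_point_less[OF consecutive_example(1)]
    unfolding ascending_stair_polynomial_def by blast
  then have "K = int k" by (simp add: p eval2_stair_poly stair_value_Suc)
  then show "\<exists>L D. bij_betw (stair_value t (int k) L D) (stair_region a h t) {0..}"
    using pack unfolding p packing_stair_poly_iff by blast
next
  assume "\<exists>L D. bij_betw (stair_value t (int k) L D) (stair_region a h t) {0..}"
  then show "\<exists>p. ascending_stair_packing_polynomial k n m p"
    unfolding ascending_stair_packing_polynomial_def stair_packing_polynomial_def
    using packing_stair_poly_iff stair_polynomial_stair_poly by blast
qed

lemma ascending_1_iff: "(\<exists>p. ascending_stair_packing_polynomial 1 n m p) \<longleftrightarrow> h = 1"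
  and ascending_2_iff: "(\<exists>p. ascending_stair_packing_polynomial 2 n m p) \<longleftrightarrow> t = 4 \<and> 2 * h = a + 1"
  and ascending_3_iff: "(\<exists>p. ascending_stair_packing_polynomial 3 n m p) \<longleftrightarrow>
    t = 3 \<and> (3 * h = a + 1 \<or> 3 * h = 2 * a + 1)"
  using bij_stair_value_1_iff[OF h_pos h_less coprime_ha t_pos]
    bij_stair_value_2_iff[OF h_pos h_less coprime_ha t_pos]
    bij_stair_value_3_iff[OF h_pos h_less coprime_ha t_pos]
  by (simp_all add: ex_ascending_iff)

lemma not_stair_packing_4: "\<not> stair_packing_polynomial 4 n m p"
proof
  assume "stair_packing_polynomial 4 n m p"
  then have stair: "stair_polynomial 4 n m p" and pack: "packing_polynomial (real_of_int n / real_of_int m) p"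
    unfolding stair_packing_polynomial_def by auto
  obtain K L D where p: "p = stair_poly K L D" and K: "\<bar>K\<bar> = int 4" using stair_polynomialE[OF stair] by blast
  have bij: "bij_betw (stair_value t K L D) (stair_region a h t) {0..}"
    using pack unfolding p packing_stair_poly_iff .
  have "K = 4 \<or> K = - 4" using K by linarith
  then show False
  proof
    assume "K = 4"
    then show False
      using bij not_bij_stair_value_4[OF h_pos h_less coprime_ha t_pos] by blast
  next
    assume "K = - 4"
    then have "bij_betw (stair_value t 4 (L - 4 * t - 4) D) (stair_region a (a - h) t) {0..}"
      using bij bij_stair_value_reflect[of t 4] by blast
    moreover have "coprime (a - h) a"
    proof (rule coprimeI)
      fix c assume "c dvd a - h" "c dvd a"
      then have "c dvd h" using dvd_diff[of c a "a - h"] by simp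
      then show "is_unit c" using coprime_ha \<open>c dvd a\<close> coprime_common_divisor by blast
    qed
    ultimately show False
      using not_bij_stair_value_4[of "a - h" a t] h_pos h_less t_pos by auto
  qed
qed

text \<open>Both \<open>k\<close> and \<open>b\<close> invert \<open>h\<close> modulo
  \<open>a\<close>. This carries conditions on \<open>h\<close> over to \<open>b\<close>, hence to
  \<open>m\<close>.\<close>

lemma dvd_diff_of_mult:
  assumes "k * h = c * a + 1"
  shows "a dvd b - k"
proof -
  have "b - k = a * (- k * g - b * c)"
    using bezout assms by algebra
  then show ?thesis by simp
qed

end

text \<open>Dividing by the gcd \<open>l\<close> leaves coprime \<open>a\<close> and
  \<open>b\<close>; divisibility then forces \<open>a dvd l\<close>, and \<open>t\<close> is the
  quotient. \<open>m < n\<close> gives \<open>b < a\<close>, so \<open>a > 1\<close> and the inverse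
  \<open>h\<close> of \<open>b\<close> is nonzero.\<close>

lemma ex_stair_lattice:
  fixes n m :: int
  assumes "0 < m" "m \<noteq> 1" "m < n" "n dvd (m - 1)\<^sup>2"
  obtains a b h g t where "stair_lattice a b h g t n m"
proof -
  define l where "l = gcd n (m - 1)"
  define a where "a = n div l"
  define b where "b = (m - 1) div l"
  have n: "n = a * l" and m: "m - 1 = b * l" by (simp_all add: a_def b_def l_def)
  have "0 < l" using assms by (simp add: l_def)
  have "0 < a * l" "0 < b * l" using assms n m by linarith+
  then have a: "0 < a" and b: "0 < b" using \<open>0 < l\<close> by (simp_all add: zero_less_mult_iff)
  have "coprime a b" using assms by (simp add: a_def b_def l_def div_gcd_coprime)
  have "a * l dvd (b\<^sup>2 * l) * l" using assms(4) unfolding n m by (simp add: power2_eq_square ac_simps)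
  then have "a dvd b\<^sup>2 * l" using \<open>0 < l\<close> by simp
  then have "a dvd l" using \<open>coprime a b\<close> by (simp add: coprime_dvd_mult_right_iff)
  then obtain t where t: "l = a * t" ..
  have "0 < t" using \<open>0 < l\<close> a t by (simp add: zero_less_mult_iff)
  have "b * l < a * l" using assms(3) n m by linarith
  then have "b < a" using \<open>0 < l\<close> by simp
  obtain x where x: "[b * x = 1] (mod a)"
    using \<open>coprime a b\<close> cong_solve_coprime_int[of b a] by (auto simp: coprime_commute)
  define h where "h = x mod a"
  have "[b * h = 1] (mod a)" using x by (simp add: h_def cong_def mod_mult_right_eq)
  then have "a dvd 1 - b * h" by (simp add: cong_iff_dvd_diff dvd_diff_commute)
  then obtain g where g: "1 - b * h = a * g" ..
  have "h \<noteq> 0"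
  proof
    assume "h = 0"
    then have "a * g = 1" using g by simp
    then have "a = 1" using a by (simp add: zmult_eq_1_iff)
    then show False using b \<open>b < a\<close> by simp
  qed
  moreover have "0 \<le> h" "h < a" using a by (simp_all add: h_def)
  ultimately have "stair_lattice a b h g t n m"
    using g b \<open>b < a\<close> \<open>0 < t\<close> n m t
    by unfold_locales (auto simp: power2_eq_square algebra_simps)
  then show thesis using that by blast
qed

theorem theorem5:
  fixes n m :: int
  assumes "n > 0" and "m > 0" and "gcd n m = 1" and "m \<noteq> 1"
    and "real_of_int n / real_of_int m > 1"
  shows "((\<exists>p. ascending_stair_packing_polynomial 1 n m p) \<longleftrightarrow>
            n dvd (m - 1)\<^sup>2 \<and> (m - 1) dvd n) \<and>
         ((\<exists>p. ascending_stair_packing_polynomial 2 n m p) \<longleftrightarrow>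
            [m = 9] (mod 16) \<and> real_of_int n = 1 / 16 * (real_of_int m - 1)\<^sup>2) \<and>
         ((\<exists>p. ascending_stair_packing_polynomial 3 n m p) \<longleftrightarrow>
            (([m = 10] (mod 27) \<or> [m = 19] (mod 27)) \<and>
              real_of_int n = 1 / 27 * (real_of_int m - 1)\<^sup>2) \<or>
            real_of_int n / real_of_int m = 12 / 7) \<and>
         \<not> (\<exists>p. stair_packing_polynomial 4 n m p)"
proof -
  have less: "m < n" using assms(2,5) by (simp add: field_simps)
  have lattice: "\<exists>a b h g t. stair_lattice a b h g t n m" if "stair_polynomial k n m p" for k p
    using ex_stair_lattice[OF assms(2,4) less stair_polynomial_dvd[OF assms(1) that]] by metis
  have lattice_asc: "\<exists>a b h g t. stair_lattice a b h g t n m"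
    if "\<exists>p. ascending_stair_packing_polynomial k n m p" for k
    using that lattice unfolding ascending_stair_packing_polynomial_def ascending_stair_polynomial_def
    by blast
  have square: "real_of_int n = 1 / real_of_int c * (real_of_int m - 1)\<^sup>2 \<longleftrightarrow> c * n = (m - 1)\<^sup>2"
    if "c > 0" for c
  proof -
    have "c * n = (m - 1)\<^sup>2 \<longleftrightarrow> real_of_int (c * n) = real_of_int ((m - 1)\<^sup>2)" by linarith
    also have "\<dots> \<longleftrightarrow> real_of_int n = 1 / real_of_int c * (real_of_int m - 1)\<^sup>2"
      using that by (simp add: field_simps)
    finally show ?thesis by blast
  qed
  have ratio: "real_of_int n / real_of_int m = 12 / 7 \<longleftrightarrow> n = 12 \<and> m = 7"
  proof
    assume "real_of_int n / real_of_int m = 12 / 7"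
    then have "real_of_int (7 * n) = real_of_int (12 * m)" using assms(2) by (simp add: field_simps)
    then have eq: "7 * n = 12 * m" by linarith
    have "coprime n m" using assms(3) by (simp add: coprime_iff_gcd_eq_1)
    then have "m dvd 7" using eq by (metis coprime_commute coprime_dvd_mult_left_iff dvd_triv_right)
    moreover have "7 dvd m" using eq by presburger
    ultimately have "m = 7" using assms(2) by (intro zdvd_antisym_nonneg) auto
    then show "n = 12 \<and> m = 7" using eq by simp
  qed simp
  have one: "(\<exists>p. ascending_stair_packing_polynomial 1 n m p) \<longleftrightarrow> n dvd (m - 1)\<^sup>2 \<and> (m - 1) dvd n"
  proof
    assume ex: "\<exists>p. ascending_stair_packing_polynomial 1 n m p"
    then obtain a b h g t where "stair_lattice a b h g t n m" using lattice_asc by blast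
    then interpret stair_lattice a b h g t n m .
    have "h = 1" using ex ascending_1_iff by simp
    then have "a dvd b - 1" using dvd_diff_of_mult[of 1 0] by simp
    then have "b = 1" using b_pos b_less zdvd_imp_le[of a "b - 1"] by force
    then show "n dvd (m - 1)\<^sup>2 \<and> (m - 1) dvd n" by (simp add: n_eq m_eq power2_eq_square)
  next
    assume dvd: "n dvd (m - 1)\<^sup>2 \<and> (m - 1) dvd n"
    then obtain a b h g t where "stair_lattice a b h g t n m"
      using ex_stair_lattice[OF assms(2,4) less] by blast
    then interpret stair_lattice a b h g t n m .
    have "b * (a * t) dvd a * (a * t)" using dvd by (simp add: n_eq m_eq power2_eq_square ac_simps)
    then have "b dvd a" using a_pos t_pos by simp
    then have "b dvd a * g + b * h" by simp
    then have "b = 1" using bezout b_pos by simp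
    then have "a dvd h - 1" using bezout by (metis add_diff_cancel_left' dvd_minus_iff dvd_triv_left
      minus_diff_eq mult_1 add.commute)
    then have "h = 1" using h_pos h_less zdvd_imp_le[of a "h - 1"] by force
    then show "\<exists>p. ascending_stair_packing_polynomial 1 n m p" using ascending_1_iff by simp
  qed
  have two: "(\<exists>p. ascending_stair_packing_polynomial 2 n m p) \<longleftrightarrow>
    [m = 9] (mod 16) \<and> 16 * n = (m - 1)\<^sup>2"
  proof
    assume ex: "\<exists>p. ascending_stair_packing_polynomial 2 n m p"
    then obtain a b h g t where "stair_lattice a b h g t n m" using lattice_asc by blast
    then interpret stair_lattice a b h g t n m .
    have t: "t = 4" and h: "2 * h = a + 1" using ex ascending_2_iff by auto
    have "a dvd b - 2" using dvd_diff_of_mult[of 2 1] h by simp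
    \<comment> \<open>Since \<open>0 < b < a\<close>, the only other candidate is
      \<open>b = 1\<close>, which would force \<open>a = 1\<close>.\<close>
    then have "b = 2"
      using b_pos b_less zdvd_imp_le[of a "b - 2"] zdvd_imp_le[of a "2 - b"]
      by (fastforce simp: dvd_diff_commute)
    moreover have "8 * a + 1 = 16 * (h - 1) + 9" using h by simp
    ultimately show "[m = 9] (mod 16) \<and> 16 * n = (m - 1)\<^sup>2"
      by (simp add: n_eq m_eq t cong_def power2_eq_square) presburger
  next
    assume R: "[m = 9] (mod 16) \<and> 16 * n = (m - 1)\<^sup>2"
    define q where "q = m div 16"
    have m: "m = 16 * q + 9" using R by (simp add: q_def cong_def) presburger
    have "16 * n = 64 * (2 * q + 1)\<^sup>2" using R by (simp add: m power2_eq_square algebra_simps)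
    then have n: "n = (2 * q + 1)\<^sup>2 * 4" by simp
    have "0 \<le> q" using m assms(2) by simp
    \<comment> \<open>\<open>q = 0\<close> would give \<open>n = 4\<close> and \<open>m = 9\<close>,
      against \<open>m < n\<close>. The cases of difference 3 exclude it likewise.\<close>
    moreover have "q \<noteq> 0" using less n m by auto
    ultimately interpret stair_lattice "2 * q + 1" 2 "q + 1" "- 1" 4 n m
      by unfold_locales (auto simp: n m)
    show "\<exists>p. ascending_stair_packing_polynomial 2 n m p" unfolding ascending_2_iff by simp
  qed
  have three: "(\<exists>p. ascending_stair_packing_polynomial 3 n m p) \<longleftrightarrow>
    ([m = 10] (mod 27) \<or> [m = 19] (mod 27)) \<and> 27 * n = (m - 1)\<^sup>2 \<or> n = 12 \<and> m = 7"
  proof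
    assume ex: "\<exists>p. ascending_stair_packing_polynomial 3 n m p"
    then obtain a b h g t where "stair_lattice a b h g t n m" using lattice_asc by blast
    then interpret stair_lattice a b h g t n m .
    have t: "t = 3" and h: "3 * h = a + 1 \<or> 3 * h = 2 * a + 1" using ex ascending_3_iff by auto
    have dvd: "a dvd b - 3" using h dvd_diff_of_mult[of 3 1] dvd_diff_of_mult[of 3 2] by auto
    have "b \<le> 3" using b_less dvd zdvd_imp_le[of a "b - 3"] by linarith
    moreover have "b \<noteq> 2"
      using b_less dvd zdvd_imp_le[of a 1] by auto
    \<comment> \<open>Here \<open>a\<close> divides 2 and exceeds 1. With \<open>t = 3\<close> this
      is the sporadic pair \<open>n = 12\<close>, \<open>m = 7\<close>.\<close>
    moreover have "a = 2" if "b = 1"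
      using that b_less dvd zdvd_imp_le[of a 2] by auto
    ultimately consider "b = 3" | "b = 1 \<and> a = 2" using b_pos by linarith
    then show "([m = 10] (mod 27) \<or> [m = 19] (mod 27)) \<and> 27 * n = (m - 1)\<^sup>2 \<or> n = 12 \<and> m = 7"
    proof cases
      case 1
      then have "27 * n = (m - 1)\<^sup>2" by (simp add: n_eq m_eq t power2_eq_square)
      moreover have "m = 9 * a + 1" using 1 by (simp add: m_eq t)
      then have "m mod 27 = 10 \<or> m mod 27 = 19" using h by presburger
      ultimately show ?thesis by (simp add: cong_def)
    next
      case 2
      then show ?thesis by (simp add: n_eq m_eq t)
    qed
  next
    assume "([m = 10] (mod 27) \<or> [m = 19] (mod 27)) \<and> 27 * n = (m - 1)\<^sup>2 \<or> n = 12 \<and> m = 7"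
    then consider "[m = 10] (mod 27)" "27 * n = (m - 1)\<^sup>2" | "[m = 19] (mod 27)" "27 * n = (m - 1)\<^sup>2"
      | "n = 12" "m = 7" by blast
    then show "\<exists>p. ascending_stair_packing_polynomial 3 n m p"
    proof cases
      case 1
      define q where "q = m div 27"
      have m: "m = 27 * q + 10" using 1(1) by (simp add: q_def cong_def) presburger
      have "27 * n = 81 * (3 * q + 1)\<^sup>2" using 1(2) by (simp add: m power2_eq_square algebra_simps)
      then have n: "n = (3 * q + 1)\<^sup>2 * 3" by simp
      have "0 \<le> q" using m assms(2) by simp
      moreover have "q \<noteq> 0" using less n m by auto
      \<comment> \<open>\<open>a\<close> is read off from \<open>m - 1 = 9 a\<close>;
        \<open>h\<close> solves \<open>3 h = 2 a + 1\<close> here and \<open>3 h = a + 1\<close> in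
        the next case.\<close>
      ultimately interpret stair_lattice "3 * q + 1" 3 "2 * q + 1" "- 2" 3 n m
        by unfold_locales (auto simp: n m)
      show ?thesis unfolding ascending_3_iff by simp
    next
      case 2
      define q where "q = m div 27"
      have m: "m = 27 * q + 19" using 2(1) by (simp add: q_def cong_def) presburger
      have "27 * n = 81 * (3 * q + 2)\<^sup>2" using 2(2) by (simp add: m power2_eq_square algebra_simps)
      then have n: "n = (3 * q + 2)\<^sup>2 * 3" by simp
      have "0 \<le> q" using m assms(2) by simp
      moreover have "q \<noteq> 0" using less n m by auto
      ultimately interpret stair_lattice "3 * q + 2" 3 "q + 1" "- 1" 3 n m
        by unfold_locales (auto simp: n m)
      show ?thesis unfolding ascending_3_iff by simp
    next
      case 3
      interpret stair_lattice 2 1 1 0 3 n m by unfold_locales (auto simp: 3)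
      show ?thesis unfolding ascending_3_iff by simp
    qed
  qed
  have four: "\<not> (\<exists>p. stair_packing_polynomial 4 n m p)"
  proof
    assume "\<exists>p. stair_packing_polynomial 4 n m p"
    then obtain p where p: "stair_packing_polynomial 4 n m p" by blast
    then obtain a b h g t where "stair_lattice a b h g t n m"
      using lattice unfolding stair_packing_polynomial_def by blast
    then show False using p stair_lattice.not_stair_packing_4 by blast
  qed
  show ?thesis
    using one two three four square[of 16] square[of 27] ratio by simp
qed

end
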